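(* Let $\sigma(u)$, $-\infty<u<\infty$, be a symmetric distribution function, and suppose that $\sigma$ generates finite moments of all orders $n\in\mathbb{Z}$. Let $$\mu_n=\int_{-\infty}^{\infty}u^n\,d\sigma(u),\qquad n\in\mathbb{Z}.$$ If $$\int_{-\infty}^{\infty}\frac{\log\sigma'(u)}{1+u^2}\,du>-\infty,$$ where $\sigma'(u)$ is the derivative of the absolutely continuous part of $\sigma(u)$, then the strong Hamburger moment problem with moment sequence $\{\mu_n\}_{n\in\mathbb{Z}}$ is indeterminate, and $\mu_n=\mu_{-n}$ for all $n\in\mathbb{Z}$.
   Context: A distribution function on an interval $I\subset\mathbb{R}$ is a real-valued, bounded, non-decreasing function on $I$ having infinitely many points of increase in $I$. Two distribution functions $\alpha_1,\alpha_2$ on $I$ are regarded as equal if $\int_I f\,d\alpha_1=\int_I f\,d\alpha_2$ for all continuous functions $f$ with compact support. A distribution function $\sigma$ on $I=]-\infty,\infty[$ is called symmetric if $d\sigma(u)=-d\sigma(1/u)$ for $u\in I\setminus\{0\}$, i.e. the measure induced by $\sigma$ on $I\setminus\{0\}$ is invariant under $u\mapsto 1/u$. The moment of order $n\in\mathbb{Z}$ of $\sigma$ on $I$ is $\int_I u^n\,d\sigma(u)$; "finite moments of all orders" means that these are finite for all $n\in\mathbb{Z}$ (positive, zero and negative); in particular $\sigma$ has no mass at the origin. The strong Hamburger moment problem for a real sequence $\{\mu_n\}_{n\in\mathbb{Z}}$ is: find a distribution function $\alpha$ on $]-\infty,\infty[$ such that $\mu_n=\int_{-\infty}^{\infty}x^n\,d\alpha(x)$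 for all $n\in\mathbb{Z}$. It is determinate if it has at most one solution $\alpha$ (up to the equality above), and indeterminate otherwise. *)

theory Defs
  imports "HOL-Analysis.Analysis"
begin

text \<open>All distribution functions live on the whole real line.\<close>

definition distribution_function :: "(real \<Rightarrow> real) \<Rightarrow> bool" where
  "distribution_function F \<longleftrightarrow>
     mono F \<and> bounded (range F) \<and>
     infinite {x. \<forall>a b. a < x \<and> x < b \<longrightarrow> F a < F b}"

text \<open>
  The measure \<open>dF\<close>. A distribution function need not be right-continuous, whereas
  \<^const>\<open>interval_measure\<close> expects a right-continuous function; hence the passage to
  the right limits \<open>F(x+)\<close>.
\<close>

definition stieltjes :: "(real \<Rightarrow> real) \<Rightarrow> real measure" where
  "stieltjes F = interval_measure (\<lambda>x. Lim (at_right x) F)"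

definition df_equal :: "(real \<Rightarrow> real) \<Rightarrow> (real \<Rightarrow> real) \<Rightarrow> bool" where
  "df_equal F G \<longleftrightarrow>
     (\<forall>f :: real \<Rightarrow> real. continuous_on UNIV f \<and> compact (closure {x. f x \<noteq> 0}) \<longrightarrow>
        (\<integral>x. f x \<partial>stieltjes F) = (\<integral>x. f x \<partial>stieltjes G))"

definition symmetric_df :: "(real \<Rightarrow> real) \<Rightarrow> bool" where
  "symmetric_df F \<longleftrightarrow>
     distr (restrict_space (stieltjes F) (- {0})) (restrict_space borel (- {0})) inverse =
     restrict_space (stieltjes F) (- {0})"

text \<open>
  In HOL \<open>0 powi n = 0\<close> for \<open>n < 0\<close>, whereas the integrand \<open>u\<^sup>n\<close> is infinite at the
  origin; finiteness of a negative moment therefore has to exclude a point mass there explicitly.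
\<close>

definition finite_moment :: "(real \<Rightarrow> real) \<Rightarrow> int \<Rightarrow> bool" where
  "finite_moment F n \<longleftrightarrow>
     integrable (stieltjes F) (\<lambda>u. u powi n) \<and>
     (n < 0 \<longrightarrow> emeasure (stieltjes F) {0} = 0)"

definition moment :: "(real \<Rightarrow> real) \<Rightarrow> int \<Rightarrow> real" where
  "moment F n = (\<integral>u. u powi n \<partial>stieltjes F)"

definition solves_strong_hamburger :: "(int \<Rightarrow> real) \<Rightarrow> (real \<Rightarrow> real) \<Rightarrow> bool" where
  "solves_strong_hamburger \<mu> F \<longleftrightarrow>
     distribution_function F \<and> (\<forall>n. finite_moment F n \<and> \<mu> n = moment F n)"

definition strong_hamburger_determinate :: "(int \<Rightarrow> real) \<Rightarrow> bool" where
  "strong_hamburger_determinate \<mu> \<longleftrightarrow>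
     (\<forall>F G. solves_strong_hamburger \<mu> F \<and> solves_strong_hamburger \<mu> G \<longrightarrow> df_equal F G)"

definition strong_hamburger_indeterminate :: "(int \<Rightarrow> real) \<Rightarrow> bool" where
  "strong_hamburger_indeterminate \<mu> \<longleftrightarrow> \<not> strong_hamburger_determinate \<mu>"

text \<open>Lebesgue decomposition of a Borel measure with respect to Lebesgue measure.\<close>

definition lebesgue_decomposition :: "real measure \<Rightarrow> real measure \<Rightarrow> real measure \<Rightarrow> bool" where
  "lebesgue_decomposition M N S \<longleftrightarrow>
     sets N = sets borel \<and> sets S = sets borel \<and>
     absolutely_continuous lborel N \<and>
     (\<exists>Z\<in>null_sets lborel. emeasure S (- Z) = 0) \<and>
     (\<forall>A\<in>sets borel. emeasure M A = emeasure N A + emeasure S A)"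

definition ac_part :: "real measure \<Rightarrow> real measure" where
  "ac_part M = (THE N. \<exists>S. lebesgue_decomposition M N S)"

lemma lebesgue_decomposition_unique:
  assumes "lebesgue_decomposition M N S" "lebesgue_decomposition M N' S'"
  shows "N = N'"
proof -
  obtain Z where Z: "Z \<in> null_sets lborel" "emeasure S (- Z) = 0"
    using assms(1) unfolding lebesgue_decomposition_def by blast
  obtain Z' where Z': "Z' \<in> null_sets lborel" "emeasure S' (- Z') = 0"
    using assms(2) unfolding lebesgue_decomposition_def by blast
  define W where "W = Z \<union> Z'"
  have W: "W \<in> null_sets lborel" "W \<in> sets borel"
    using null_sets.Un[OF Z(1) Z'(1)] by (auto simp: W_def dest: null_setsD2)
  have restr: "emeasure K A = emeasure M (A - W)"
    if d: "lebesgue_decomposition M K T" and Y: "Y \<subseteq> W" "Y \<in> sets borel" "emeasure T (- Y) = 0"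
      and A: "A \<in> sets borel" for K T Y A
  proof -
    have sK: "sets K = sets borel" and sT: "sets T = sets borel"
      and ac: "W \<in> null_sets K"
      and eq: "emeasure M (A - W) = emeasure K (A - W) + emeasure T (A - W)"
      using d W A unfolding lebesgue_decomposition_def absolutely_continuous_def by auto
    have "emeasure T (A - W) \<le> emeasure T (- Y)"
      using Y sT by (intro emeasure_mono) (auto simp: Compl_eq_Diff_UNIV)
    moreover have "emeasure K (A - W) = emeasure K A"
      using ac A sK by (intro emeasure_Diff_null_set) auto
    ultimately show ?thesis using eq Y by simp
  qed
  have b: "Z \<in> sets borel" "Z' \<in> sets borel"
    using Z(1) Z'(1) by (auto simp: null_sets_def)
  have s: "sets N = sets borel" "sets N' = sets borel"
    using assms unfolding lebesgue_decomposition_def by auto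
  show ?thesis
  proof (rule measure_eqI)
    show "sets N = sets N'" using s by simp
    fix A assume "A \<in> sets N"
    then have A: "A \<in> sets borel" using s by simp
    show "emeasure N A = emeasure N' A"
      using restr[OF assms(1) _ b(1) Z(2) A] restr[OF assms(2) _ b(2) Z'(2) A]
      by (simp add: W_def)
  qed
qed

lemma lebesgue_decomposition_ex:
  assumes M: "sets M = sets borel" "finite_measure M"
  shows "\<exists>N S. lebesgue_decomposition M N S"
proof -
  interpret finite_measure M by fact
  have "null_sets lborel \<noteq> ({} :: real set set)"
    by blast
  from ennreal_SUP_countable_SUP[OF this, of "emeasure M"]
  obtain f :: "nat \<Rightarrow> ennreal" where f: "range f \<subseteq> emeasure M ` null_sets lborel"
    and sup: "(SUP A\<in>null_sets lborel. emeasure M A) = (SUP i. f i)"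
    by blast
  have "\<forall>i. \<exists>A\<in>null_sets lborel. f i = emeasure M A" using f by blast
  then obtain Y where Y: "\<And>i. Y i \<in> null_sets lborel" "\<And>i. f i = emeasure M (Y i)"
    by metis
  define Z where "Z = (\<Union>i. Y i)"
  have Z0: "Z \<in> null_sets lborel" using Y unfolding Z_def by auto
  then have Zs: "Z \<in> sets M" using M by (auto simp: null_sets_def)
  have max: "emeasure M A \<le> emeasure M Z" if "A \<in> null_sets lborel" for A
  proof -
    have "emeasure M A \<le> (SUP i. f i)" unfolding sup[symmetric] using that by (rule SUP_upper)
    also have "\<dots> \<le> emeasure M Z"
      unfolding Y(2) using Zs by (intro SUP_least emeasure_mono) (auto simp: Z_def)
    finally show ?thesis .
  qed
  have null: "emeasure M (A - Z) = 0" if A: "A \<in> null_sets lborel" for A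
  proof -
    have AZ: "A - Z \<in> sets M" using A Zs M by (auto simp: null_sets_def)
    have "emeasure M Z + emeasure M (A - Z) = emeasure M (Z \<union> (A - Z))"
      using AZ Zs by (intro plus_emeasure) auto
    also have "\<dots> \<le> emeasure M Z"
      using max[of "Z \<union> A"] A Z0 by (simp add: null_sets.Un)
    finally have "emeasure M Z + emeasure M (A - Z) \<le> emeasure M Z + 0" by simp
    then show ?thesis
      using emeasure_finite[of Z] by (subst (asm) ennreal_add_left_cancel_le) auto
  qed
  define N where "N = density M (indicator (- Z))"
  define S where "S = density M (indicator Z)"
  have sp: "space M = UNIV" using M(1) by (metis sets_eq_imp_space_eq space_borel)
  have cZ: "- Z \<in> sets M" using Zs sp by (metis Compl_eq_Diff_UNIV sets.compl_sets)
  have eN: "emeasure N A = emeasure M (A - Z)" if "A \<in> sets borel" for A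
    using that M Zs cZ unfolding N_def
    by (subst emeasure_density) (auto simp: indicator_inter_arith[symmetric] Diff_eq Int_commute)
  have eS: "emeasure S A = emeasure M (A \<inter> Z)" if "A \<in> sets borel" for A
    using that M Zs unfolding S_def
    by (subst emeasure_density) (auto simp: indicator_inter_arith[symmetric] Int_commute)
  have "lebesgue_decomposition M N S"
    unfolding lebesgue_decomposition_def
  proof (intro conjI ballI)
    show "sets N = sets borel" "sets S = sets borel" using M by (simp_all add: N_def S_def)
    then show "absolutely_continuous lborel N"
      unfolding absolutely_continuous_def using null eN by (auto simp: null_sets_def)
    show "\<exists>Z\<in>null_sets lborel. emeasure S (- Z) = 0"
      using Z0 cZ M eS[of "- Z"] by auto
    fix A :: "real set" assume A: "A \<in> sets borel"
    have "emeasure M A = emeasure M ((A - Z) \<union> (A \<inter> Z))" by (simp add: Un_Diff_Int)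
    also have "\<dots> = emeasure M (A - Z) + emeasure M (A \<inter> Z)"
      using A Zs M by (intro plus_emeasure[symmetric]) auto
    finally show "emeasure M A = emeasure N A + emeasure S A" using eN[OF A] eS[OF A] by simp
  qed
  then show ?thesis by blast
qed

lemma lebesgue_decomposition_ac_part:
  assumes "sets M = sets borel" "finite_measure M"
  shows "\<exists>S. lebesgue_decomposition M (ac_part M) S"
proof -
  obtain N S where "lebesgue_decomposition M N S"
    using lebesgue_decomposition_ex[OF assms] by blast
  then have "\<exists>!N. \<exists>S. lebesgue_decomposition M N S"
    using lebesgue_decomposition_unique by blast
  then show ?thesis
    unfolding ac_part_def by (rule theI')
qed

text \<open>
  \<open>\<sigma>'\<close>: the derivative, with respect to Lebesgue measure, of the absolutely continuous part.
\<close>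

definition ac_derivative :: "(real \<Rightarrow> real) \<Rightarrow> real \<Rightarrow> ennreal" where
  "ac_derivative F = RN_deriv lborel (ac_part (stieltjes F))"

text \<open>The real logarithm \<^const>\<open>ln\<close> has \<open>ln 0 = 0\<close>; here \<open>log 0 = -\<infinity>\<close>.\<close>

definition log_ext :: "ennreal \<Rightarrow> ereal" where
  "log_ext x = (if x = 0 then - \<infinity> else if x = \<infinity> then \<infinity> else ereal (ln (enn2real x)))"

text \<open>
  Integral of an extended real function, as positive part minus negative part
  (\<^const>\<open>e2ennreal\<close> truncates negative values to 0). In \<^typ>\<open>ereal\<close>, \<open>\<infinity> - \<infinity> = \<infinity>\<close>; for the
  logarithmic integral below that case is void, since \<open>log x \<le> x\<close> and the density of a finite
  measure is integrable, so the positive part is finite.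
\<close>

definition integral_ext :: "'a measure \<Rightarrow> ('a \<Rightarrow> ereal) \<Rightarrow> ereal" where
  "integral_ext M g =
     enn2ereal (\<integral>\<^sup>+x. e2ennreal (g x) \<partial>M) - enn2ereal (\<integral>\<^sup>+x. e2ennreal (- g x) \<partial>M)"

definition log_integral :: "(real \<Rightarrow> real) \<Rightarrow> ereal" where
  "log_integral F =
     integral_ext lborel (\<lambda>u. log_ext (ac_derivative F u) / ereal (1 + u\<^sup>2))"

end

theory Submission
  imports Defs
    "HOL-Complex_Analysis.Cauchy_Integral_Formula"
    "HOL-Computational_Algebra.Fundamental_Theorem_Algebra"
    "HOL-Library.Function_Algebras"
    "HOL-Probability.Distribution_Functions"
begin

text \<open>
  The measure \<open>d\<sigma>\<close> is itself a solution, so indeterminacy follows from one further solution with a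
  different integral of some bounded continuous function; \<open>f\<^sub>0(u) = 1/(1+u\<^sup>2)\<close> serves as the witness. The
  point is that the logarithmic integral keeps \<open>f\<^sub>0\<close> at a positive \<open>L\<^sup>1(d\<sigma>)\<close>-distance from all Laurent
  polynomials \<open>p\<close>.

  To see this (\<open>laurent_distance\<close>), put \<open>P = 1 - (1+u\<^sup>2) p\<close>. As \<open>1+u\<^sup>2\<close> vanishes at \<open>\<i>\<close>, one has
  \<open>P(\<i>) = 1\<close> for every \<open>p\<close>; since \<open>ln \<bar>P\<bar>\<close> is subharmonic in the upper half plane, its integral against
  the Poisson kernel \<open>K(u) = 1/(\<pi>(1+u\<^sup>2))\<close> of the point \<open>\<i>\<close> is nonnegative (\<open>laurent_sub_mean_value\<close>,
  proved by factoring into linear factors and transporting to the unit circle). Because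
  \<open>\<bar>f\<^sub>0 - p\<bar> = \<pi> K \<bar>P\<bar>\<close>, Jensen's inequality gives
  \<open>\<integral>\<bar>f\<^sub>0 - p\<bar> d\<sigma> \<ge> \<pi> \<integral> K \<bar>P\<bar> \<sigma>' du \<ge> \<pi> exp (\<integral> K ln \<sigma>' du) > 0\<close>.

  By Hahn--Banach (\<open>separating_linear_functional\<close>) there is a functional \<open>l\<close> of norm at most 1 on
  \<open>L\<^sup>1(d\<sigma>)\<close> which kills all Laurent polynomials but not \<open>f\<^sub>0\<close>. The set function
  \<open>\<nu>(A) = \<sigma>(A) + l(1\<^sub>A)/2\<close> is then a measure between \<open>d\<sigma>/2\<close> and \<open>3d\<sigma>/2\<close> (\<open>perturbed_measure\<close>) with the
  same moments as \<open>d\<sigma>\<close> and a different integral of \<open>f\<^sub>0\<close>. The symmetry of \<open>\<sigma>\<close> gives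
  \<open>\<mu>\<^sub>n = \<mu>\<^sub>-\<^sub>n\<close> by the substitution \<open>u \<mapsto> 1/u\<close>.
\<close>

section \<open>The Hahn--Banach theorem for sublinear functionals\<close>

text \<open>
  The functionals used below live on the integrable functions, a proper subspace of all functions, so
  sublinearity is relative to a carrier \<open>E\<close>. Demanding only the inequality for positive factors is
  enough: applied to \<open>c\<close> and \<open>1/c\<close> it gives positive homogeneity.
\<close>

definition sublinear_on :: "'a::real_vector set \<Rightarrow> ('a \<Rightarrow> real) \<Rightarrow> bool" where
  "sublinear_on E q \<longleftrightarrow>
     (\<forall>x\<in>E. \<forall>y\<in>E. q (x + y) \<le> q x + q y) \<and> (\<forall>c>0. \<forall>x\<in>E. q (c *\<^sub>R x) \<le> c * q x)"

lemma sublinear_onI: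
  assumes "\<And>x y. x \<in> E \<Longrightarrow> y \<in> E \<Longrightarrow> q (x + y) \<le> q x + q y"
    and "\<And>c x. c > 0 \<Longrightarrow> x \<in> E \<Longrightarrow> q (c *\<^sub>R x) \<le> c * q x"
  shows "sublinear_on E q"
  using assms by (auto simp: sublinear_on_def)

lemma sublinear_on_add: "sublinear_on E q \<Longrightarrow> x \<in> E \<Longrightarrow> y \<in> E \<Longrightarrow> q (x + y) \<le> q x + q y"
  by (auto simp: sublinear_on_def)

lemma sublinear_on_zero:
  assumes "subspace E" "sublinear_on E q"
  shows "q 0 = 0"
proof -
  have "q (c *\<^sub>R 0) \<le> c * q 0" if "c > 0" for c
    using assms that subspace_0[of E] unfolding sublinear_on_def by blast
  from this[of "1/2"] this[of 2] show ?thesis by simp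
qed

lemma sublinear_on_scale:
  assumes "subspace E" "sublinear_on E q" "x \<in> E" "c \<ge> 0"
  shows "q (c *\<^sub>R x) = c * q x"
proof (cases "c = 0")
  case True
  then show ?thesis using sublinear_on_zero[OF assms(1,2)] by simp
next
  case False
  then have c: "c > 0" using assms by simp
  have le: "q (d *\<^sub>R y) \<le> d * q y" if "d > 0" "y \<in> E" for d y
    using assms(2) that unfolding sublinear_on_def by blast
  have "q ((1/c) *\<^sub>R (c *\<^sub>R x)) \<le> (1/c) * q (c *\<^sub>R x)"
    using c assms by (intro le) (auto simp: subspace_scale)
  then have "c * q x \<le> q (c *\<^sub>R x)" using c by (simp add: field_simps)
  with le[OF c assms(3)] show ?thesis by simp
qed

lemma sublinear_on_minus:
  assumes "subspace E" "sublinear_on E q" "x \<in> E"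
  shows "- q (- x) \<le> q x"
proof -
  have "q (x + - x) \<le> q x + q (- x)"
    using assms by (intro sublinear_on_add[of E]) (auto simp: subspace_neg)
  then show ?thesis using sublinear_on_zero[OF assms(1,2)] by simp
qed

text \<open>
  A sublinear functional can be pushed down in a given direction: the infimum over \<open>t \<ge> 0\<close> of
  \<open>q (x + t y) - t q(y)\<close> is again sublinear, lies below \<open>q\<close> (take \<open>t = 0\<close>), and at \<open>-y\<close> has dropped to
  at most \<open>-q(y)\<close> (take \<open>t = 1\<close>). This makes a minimal sublinear functional odd, and it lets one
  prescribe a large value at one chosen vector.
\<close>

lemma sublinear_on_lower_direction:
  assumes E: "subspace E" and q: "sublinear_on E q" and y: "y \<in> E"
  shows "\<exists>r. sublinear_on E r \<and> (\<forall>x\<in>E. r x \<le> q x) \<and> r (- y) \<le> - q y"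
proof -
  define r where "r x = (INF t\<in>{0..}. q (x + t *\<^sub>R y) - t * q y)" for x
  have bdd: "bdd_below ((\<lambda>t. q (x + t *\<^sub>R y) - t * q y) ` {0..})" if "x \<in> E" for x
  proof (rule bdd_belowI2[where m = "- q (- x)"])
    fix t :: real assume t: "t \<in> {0..}"
    have "t * q y = q ((x + t *\<^sub>R y) + - x)"
      using sublinear_on_scale[OF E q y, of t] t by simp
    also have "\<dots> \<le> q (x + t *\<^sub>R y) + q (- x)"
      using that y E by (intro sublinear_on_add[OF q])
        (auto simp: subspace_add subspace_neg subspace_scale)
    finally show "- q (- x) \<le> q (x + t *\<^sub>R y) - t * q y" by simp
  qed
  have le: "r x \<le> q (x + t *\<^sub>R y) - t * q y" if "x \<in> E" "t \<ge> 0" for x t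
    unfolding r_def using that by (intro cINF_lower[OF bdd]) auto
  have greatest: "m \<le> r x" if "\<And>t. t \<ge> 0 \<Longrightarrow> m \<le> q (x + t *\<^sub>R y) - t * q y" for m x
    unfolding r_def using that by (intro cINF_greatest) auto
  have "sublinear_on E r"
  proof (rule sublinear_onI)
    fix x x' assume x: "x \<in> E" "x' \<in> E"
    have "r (x + x') - (q (x' + t *\<^sub>R y) - t * q y) \<le> r x" if "t \<ge> 0" for t
    proof (rule greatest)
      fix s :: real assume "s \<ge> 0"
      have "r (x + x') \<le> q ((x + x') + (s + t) *\<^sub>R y) - (s + t) * q y"
        using x E \<open>s \<ge> 0\<close> that by (intro le) (auto simp: subspace_add)
      also have "(x + x') + (s + t) *\<^sub>R y = (x + s *\<^sub>R y) + (x' + t *\<^sub>R y)"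
        by (simp add: scaleR_add_left)
      also have "q \<dots> \<le> q (x + s *\<^sub>R y) + q (x' + t *\<^sub>R y)"
        using x y E by (intro sublinear_on_add[OF q]) (auto simp: subspace_add subspace_scale)
      finally show "r (x + x') - (q (x' + t *\<^sub>R y) - t * q y) \<le> q (x + s *\<^sub>R y) - s * q y"
        by (simp add: algebra_simps)
    qed
    then have "r (x + x') - r x \<le> r x'"
      by (intro greatest) (simp add: algebra_simps)
    then show "r (x + x') \<le> r x + r x'" by simp
  next
    fix c :: real and x assume c: "c > 0" and x: "x \<in> E"
    have "r (c *\<^sub>R x) / c \<le> r x"
    proof (rule greatest)
      fix t :: real assume t: "t \<ge> 0"
      have "r (c *\<^sub>R x) \<le> q (c *\<^sub>R x + (c * t) *\<^sub>R y) - (c * t) * q y"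
        using x c t E by (intro le) (auto simp: subspace_scale)
      also have "c *\<^sub>R x + (c * t) *\<^sub>R y = c *\<^sub>R (x + t *\<^sub>R y)"
        by (simp add: scaleR_add_right)
      also have "q \<dots> = c * q (x + t *\<^sub>R y)"
        using x y E c by (intro sublinear_on_scale[OF E q]) (auto simp: subspace_add subspace_scale)
      finally show "r (c *\<^sub>R x) / c \<le> q (x + t *\<^sub>R y) - t * q y"
        using c by (simp add: field_simps)
    qed
    then show "r (c *\<^sub>R x) \<le> c * r x" using c by (simp add: field_simps)
  qed
  moreover have "r x \<le> q x" if "x \<in> E" for x
    using le[OF that, of 0] by simp
  moreover have "r (- y) \<le> - q y"
    using le[of "- y" 1] y E sublinear_on_zero[OF E q] by (simp add: subspace_neg)
  ultimately show ?thesis by blast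
qed

text \<open>
  Hahn--Banach. By Zorn's lemma there is a minimal sublinear functional below \<open>p\<close>; since it cannot be
  pushed down in any direction it is odd, and an odd sublinear functional is linear.
\<close>

lemma linear_minorant_of_sublinear:
  fixes E :: "'a::real_vector set"
  assumes E: "subspace E" and p: "sublinear_on E p"
  shows "\<exists>l. (\<forall>x\<in>E. \<forall>y\<in>E. l (x + y) = l x + l y) \<and> (\<forall>c. \<forall>x\<in>E. l (c *\<^sub>R x) = c * l x) \<and>
             (\<forall>x\<in>E. l x \<le> p x)"
proof -
  define A where "A = {q. sublinear_on E q \<and> (\<forall>x\<in>E. q x \<le> p x) \<and> (\<forall>x. x \<notin> E \<longrightarrow> q x = 0)}"
  define P where "P q r \<longleftrightarrow> (\<forall>x. r x \<le> q x)" for q r :: "'a \<Rightarrow> real"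
  \<comment> \<open>Values off \<open>E\<close> are normalised to 0, so that the pointwise order is antisymmetric.\<close>
  define cut where "cut q x = (if x \<in> E then q x else (0::real))" for q x
  have cutA: "cut q \<in> A" if "sublinear_on E q" "\<And>x. x \<in> E \<Longrightarrow> q x \<le> p x" for q
    using that E unfolding A_def cut_def
    by (auto simp: sublinear_on_def subspace_add subspace_scale)
  have "\<exists>m\<in>A. \<forall>q\<in>A. P m q \<longrightarrow> q = m"
  proof (rule predicate_Zorn)
    show "partial_order_on A (relation_of P A)"
      by (rule partial_order_on_relation_ofI) (auto simp: P_def fun_eq_iff intro: order.trans antisym)
    fix C assume C: "C \<in> Chains (relation_of P A)"
    then have CA: "C \<subseteq> A" and chain: "\<And>q r. q \<in> C \<Longrightarrow> r \<in> C \<Longrightarrow> P q r \<or> P r q"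
      unfolding Chains_def relation_of_def by auto
    show "\<exists>u\<in>A. \<forall>q\<in>C. P q u"
    proof (cases "C = {}")
      case True
      then show ?thesis using cutA[OF p] by auto
    next
      case False
      define u where "u x = (INF q\<in>C. q x)" for x
      have bdd: "bdd_below ((\<lambda>q. q x) ` C)" if "x \<in> E" for x
      proof (rule bdd_belowI2[where m = "- p (- x)"])
        fix q assume "q \<in> C"
        then have q: "sublinear_on E q" "q (- x) \<le> p (- x)"
          using CA that E by (auto simp: A_def subspace_neg)
        with sublinear_on_minus[OF E q(1) that] show "- p (- x) \<le> q x" by linarith
      qed
      have le: "u x \<le> q x" if "x \<in> E" "q \<in> C" for x q
        unfolding u_def using that by (intro cINF_lower[OF bdd]) auto
      have greatest: "m \<le> u x" if "\<And>q. q \<in> C \<Longrightarrow> m \<le> q x" for m x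
        unfolding u_def using that False by (intro cINF_greatest) auto
      have "sublinear_on E u"
      proof (rule sublinear_onI)
        fix x y assume x: "x \<in> E" "y \<in> E"
        have "u (x + y) - r y \<le> u x" if r: "r \<in> C" for r
        proof (rule greatest)
          fix q assume q: "q \<in> C"
          \<comment> \<open>In a chain the smaller of the two functionals bounds both values.\<close>
          obtain s where s: "s \<in> C" "s x \<le> q x" "s y \<le> r y"
            using chain[OF q r] q r unfolding P_def by blast
          have "u (x + y) \<le> s (x + y)" using x s E by (intro le) (auto simp: subspace_add)
          also have "\<dots> \<le> s x + s y" using s CA x by (intro sublinear_on_add[of E]) (auto simp: A_def)
          finally show "u (x + y) - r y \<le> q x" using s by linarith
        qed
        then have "u (x + y) - u x \<le> u y" by (intro greatest) (simp add: algebra_simps)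
        then show "u (x + y) \<le> u x + u y" by simp
      next
        fix c :: real and x assume c: "c > 0" "x \<in> E"
        have "u (c *\<^sub>R x) / c \<le> u x"
        proof (rule greatest)
          fix q assume q: "q \<in> C"
          have "u (c *\<^sub>R x) \<le> q (c *\<^sub>R x)" using c E q by (intro le) (auto simp: subspace_scale)
          also have "\<dots> = c * q x" using c q CA by (intro sublinear_on_scale[OF E]) (auto simp: A_def)
          finally show "u (c *\<^sub>R x) / c \<le> q x" using c by (simp add: field_simps)
        qed
        then show "u (c *\<^sub>R x) \<le> c * u x" using c by (simp add: field_simps)
      qed
      moreover have "u x \<le> p x" if "x \<in> E" for x
      proof -
        obtain q where "q \<in> C" using False by blast
        then show ?thesis using le[OF that, of q] CA that by (fastforce simp: A_def)
      qed
      ultimately have "cut u \<in> A" by (rule cutA)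
      moreover have "P q (cut u)" if "q \<in> C" for q
        using that le CA by (auto simp: P_def cut_def A_def)
      ultimately show ?thesis by blast
    qed
  qed
  then obtain l where lA: "l \<in> A" and minimal: "\<And>q. q \<in> A \<Longrightarrow> P l q \<Longrightarrow> q = l" by blast
  have l: "sublinear_on E l" "\<And>x. x \<in> E \<Longrightarrow> l x \<le> p x" "\<And>x. x \<notin> E \<Longrightarrow> l x = 0"
    using lA by (auto simp: A_def)
  have neg: "l (- y) = - l y" if y: "y \<in> E" for y
  proof -
    obtain r where r: "sublinear_on E r" "\<And>x. x \<in> E \<Longrightarrow> r x \<le> l x" "r (- y) \<le> - l y"
      using sublinear_on_lower_direction[OF E l(1) y] by blast
    have "cut r = l"
    proof (rule minimal)
      show "cut r \<in> A" using r(2) l(2) by (intro cutA[OF r(1)]) (meson order.trans)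
      show "P l (cut r)" using r(2) l(3) by (auto simp: P_def cut_def)
    qed
    then have "l (- y) = r (- y)" using y E by (auto simp: cut_def subspace_neg)
    then show ?thesis using r(3) sublinear_on_minus[OF E l(1) y] by linarith
  qed
  have add: "l (x + y) = l x + l y" if "x \<in> E" "y \<in> E" for x y
  proof -
    have "l ((x + y) + - y) \<le> l (x + y) + l (- y)"
      using that E by (intro sublinear_on_add[OF l(1)]) (auto simp: subspace_add subspace_neg)
    then show ?thesis using neg[OF that(2)] sublinear_on_add[OF l(1) that] by simp
  qed
  have scale: "l (c *\<^sub>R x) = c * l x" if "x \<in> E" for c x
  proof (cases "c \<ge> 0")
    case True
    then show ?thesis using sublinear_on_scale[OF E l(1) that] by simp
  next
    case False
    then have "l ((- c) *\<^sub>R x) = - c * l x" using sublinear_on_scale[OF E l(1) that, of "- c"] by simp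
    moreover have "l (- (c *\<^sub>R x)) = - l (c *\<^sub>R x)" using that E by (intro neg) (auto simp: subspace_scale)
    ultimately show ?thesis by simp
  qed
  show ?thesis using add scale l(2) by blast
qed

text \<open>
  The distance \<open>q\<close> to \<open>W\<close>, measured in the seminorm \<open>N\<close>, is sublinear, bounded by \<open>N\<close> and nonpositive
  on \<open>W\<close>. Pushing it down in the direction \<open>y\<close> before taking a linear minorant forces the value at
  \<open>y\<close> to be at least \<open>q y \<ge> d\<close>.
\<close>

lemma separating_linear_functional:
  fixes E W :: "'a::real_vector set"
  assumes E: "subspace E" and W: "subspace W" "W \<subseteq> E" and N: "sublinear_on E N"
    and N_neg: "\<And>x. x \<in> E \<Longrightarrow> N (- x) = N x"
    and y: "y \<in> E" and far: "\<And>w. w \<in> W \<Longrightarrow> d \<le> N (y - w)"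
  shows "\<exists>l. (\<forall>x\<in>E. \<forall>y\<in>E. l (x + y) = l x + l y) \<and> (\<forall>c. \<forall>x\<in>E. l (c *\<^sub>R x) = c * l x) \<and>
             (\<forall>x\<in>E. \<bar>l x\<bar> \<le> N x) \<and> (\<forall>w\<in>W. l w = 0) \<and> d \<le> l y"
proof -
  define q where "q x = (INF w\<in>W. N (x - w))" for x
  have N_nonneg: "N x \<ge> 0" if "x \<in> E" for x
    using sublinear_on_minus[OF E N that] N_neg[OF that] by simp
  have bdd: "bdd_below ((\<lambda>w. N (x - w)) ` W)" if "x \<in> E" for x
    using that W E N_nonneg by (intro bdd_belowI2[where m = 0]) (auto simp: subspace_diff)
  have le: "q x \<le> N (x - w)" if "x \<in> E" "w \<in> W" for x w
    unfolding q_def using that by (intro cINF_lower[OF bdd]) auto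
  have greatest: "m \<le> q x" if "\<And>w. w \<in> W \<Longrightarrow> m \<le> N (x - w)" for m x
    unfolding q_def using that subspace_0[OF W(1)] by (intro cINF_greatest) auto
  have q: "sublinear_on E q"
  proof (rule sublinear_onI)
    fix x x' assume x: "x \<in> E" "x' \<in> E"
    have "q (x + x') - N (x' - w') \<le> q x" if w': "w' \<in> W" for w'
    proof (rule greatest)
      fix w assume w: "w \<in> W"
      have "q (x + x') \<le> N ((x + x') - (w + w'))"
        using x w w' W E by (intro le) (auto simp: subspace_add)
      also have "(x + x') - (w + w') = (x - w) + (x' - w')" by simp
      also have "N \<dots> \<le> N (x - w) + N (x' - w')"
        using x w w' W E by (intro sublinear_on_add[OF N]) (auto simp: subspace_diff)
      finally show "q (x + x') - N (x' - w') \<le> N (x - w)" by simp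
    qed
    then have "q (x + x') - q x \<le> q x'" by (intro greatest) (simp add: algebra_simps)
    then show "q (x + x') \<le> q x + q x'" by simp
  next
    fix c :: real and x assume c: "c > 0" "x \<in> E"
    have "q (c *\<^sub>R x) / c \<le> q x"
    proof (rule greatest)
      fix w assume w: "w \<in> W"
      have "q (c *\<^sub>R x) \<le> N (c *\<^sub>R x - c *\<^sub>R w)"
        using c w W E by (intro le) (auto simp: subspace_scale)
      also have "\<dots> = N (c *\<^sub>R (x - w))" by (simp add: scaleR_diff_right)
      also have "\<dots> = c * N (x - w)"
        using c w W E by (intro sublinear_on_scale[OF E N]) (auto simp: subspace_diff)
      finally show "q (c *\<^sub>R x) / c \<le> N (x - w)" using c by (simp add: field_simps)
    qed
    then show "q (c *\<^sub>R x) \<le> c * q x" using c by (simp add: field_simps)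
  qed
  obtain r where r: "sublinear_on E r" "\<And>x. x \<in> E \<Longrightarrow> r x \<le> q x" "r (- y) \<le> - q y"
    using sublinear_on_lower_direction[OF E q y] by blast
  obtain l where add: "\<And>x y. x \<in> E \<Longrightarrow> y \<in> E \<Longrightarrow> l (x + y) = l x + l y"
    and scale: "\<And>c x. x \<in> E \<Longrightarrow> l (c *\<^sub>R x) = c * l x" and lr: "\<And>x. x \<in> E \<Longrightarrow> l x \<le> r x"
    using linear_minorant_of_sublinear[OF E r(1)] by blast
  have neg: "l (- x) = - l x" if "x \<in> E" for x using scale[OF that, of "- 1"] by simp
  have lq: "l x \<le> q x" if "x \<in> E" for x using lr[OF that] r(2)[OF that] by linarith
  have lN: "l x \<le> N x" if "x \<in> E" for x
    using lq[OF that] le[OF that subspace_0[OF W(1)]] by simp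
  have "\<bar>l x\<bar> \<le> N x" if "x \<in> E" for x
    using lN[OF that] lN[of "- x"] neg[OF that] N_neg[OF that] that E by (simp add: subspace_neg)
  moreover have "l w = 0" if "w \<in> W" for w
  proof -
    have "l v \<le> 0" if "v \<in> W" for v
      using lq[of v] le[of v v] that W sublinear_on_zero[OF E N] by auto
    from this[OF that] this[of "- w"] neg[of w] show ?thesis
      using that W by (simp add: subspace_neg subset_iff)
  qed
  moreover have "d \<le> l y"
  proof -
    have "l (- y) \<le> - q y" using lr[of "- y"] r(3) y E by (simp add: subspace_neg)
    moreover have "d \<le> q y" using far by (rule greatest)
    ultimately show ?thesis using neg[OF y] by linarith
  qed
  ultimately show ?thesis using add scale by blast
qed

section \<open>Sub-mean-value inequalities on the real line\<close>

text \<open>The Poisson kernel of the upper half plane at the point \<open>\<i>\<close>.\<close>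

definition cauchy_density :: "real \<Rightarrow> real" where
  "cauchy_density x = 1 / (pi * (1 + x\<^sup>2))"

text \<open>
  The Cayley transform restricted to the real line; it maps \<open>\<i>\<close> to the centre of the unit disc and the
  line to the unit circle.
\<close>

definition cayley :: "real \<Rightarrow> complex" where
  "cayley x = (of_real x - \<i>) / (of_real x + \<i>)"

lemma of_real_plus_i_nonzero [simp]: "complex_of_real x + \<i> \<noteq> 0" "complex_of_real x - \<i> \<noteq> 0"
  by (auto simp: complex_eq_iff)

lemma cauchy_density_pos: "cauchy_density x > 0"
  by (auto simp: cauchy_density_def intro!: divide_pos_pos mult_pos_pos add_pos_nonneg)

lemma cauchy_density_measurable [measurable]: "cauchy_density \<in> borel_measurable borel"
  unfolding cauchy_density_def by measurable

lemma cayley_measurable [measurable]: "cayley \<in> borel_measurable borel"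
  unfolding cayley_def by (intro borel_measurable_continuous_onI continuous_intros) auto

lemma norm_cayley [simp]: "norm (cayley x) = 1"
proof -
  have "norm (of_real x - \<i>) = norm (of_real x + \<i>)" by (simp add: cmod_def)
  then show ?thesis by (simp add: cayley_def norm_divide)
qed

text \<open>
  Under \<open>x = tan (\<pi> (t - 1/2))\<close> the Cauchy distribution becomes the uniform distribution on the unit
  interval; \<open>cayley_tan\<close> shows that \<open>t\<close> is then the angle, in full turns, of the Cayley transform.
\<close>

lemma has_bochner_integral_cauchy_density:
  fixes H :: "real \<Rightarrow> real"
  assumes [measurable]: "H \<in> borel_measurable borel"
    and abs: "(\<lambda>t. H (tan (pi * (t - 1/2)))) absolutely_integrable_on {0<..<1}"
  shows "has_bochner_integral lborel (\<lambda>x. cauchy_density x * H x)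
           (integral {0<..<1} (\<lambda>t. H (tan (pi * (t - 1/2)))))"
proof -
  define g where "g t = tan (pi * (t - 1/2))" for t :: real
  define g' where "g' t = pi / (cos (pi * (t - 1/2)))\<^sup>2" for t :: real
  have cos_pos: "cos (pi * (t - 1/2)) > 0" if "t \<in> {0<..<1}" for t
    using that by (intro cos_gt_zero_pi) (auto simp: field_simps)
  have der: "(g has_field_derivative g' t) (at t within {0<..<1})" if "t \<in> {0<..<1}" for t
    unfolding g_def g'_def using cos_pos[OF that]
    by (auto intro!: derivative_eq_intros simp: field_simps)
  have range: "g ` {0<..<1} = UNIV"
  proof (intro equalityI subsetI)
    fix x :: real
    have "- (pi / 2) < arctan x \<and> arctan x < pi / 2" by (rule arctan_bounded)
    then have "1/2 + arctan x / pi \<in> {0<..<1}" by (auto simp: field_simps)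
    moreover have "g (1/2 + arctan x / pi) = x" by (simp add: g_def tan_arctan)
    ultimately show "x \<in> g ` {0<..<1}" by (metis image_eqI)
  qed simp
  have inj: "inj_on g {0<..<1}"
  proof (rule inj_onI)
    fix s t :: real assume st: "s \<in> {0<..<1}" "t \<in> {0<..<1}" and eq: "g s = g t"
    have "arctan (g r) = pi * (r - 1/2)" if "r \<in> {0<..<1}" for r
      unfolding g_def using that by (intro arctan_tan) (auto simp: field_simps)
    then have "pi * (s - 1/2) = pi * (t - 1/2)" using st eq by metis
    then show "s = t" by simp
  qed
  have jac: "\<bar>g' t\<bar> * (cauchy_density (g t) * H (g t)) = H (g t)" if "t \<in> {0<..<1}" for t
  proof -
    define C where "C = cos (pi * (t - 1/2))"
    have C: "C > 0" using cos_pos[OF that] by (simp add: C_def)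
    have "1 + (g t)\<^sup>2 = 1 / C\<^sup>2"
      using tan_sec[of "pi * (t - 1/2)"] C by (simp add: g_def C_def power_inverse field_simps)
    then have "\<bar>g' t\<bar> * cauchy_density (g t) = 1"
      using C by (simp add: g'_def cauchy_density_def C_def[symmetric])
    then show ?thesis by simp
  qed
  have "(\<lambda>t. \<bar>g' t\<bar> * (cauchy_density (g t) * H (g t))) absolutely_integrable_on {0<..<1}"
    using abs by (subst set_integrable_cong[OF refl refl jac]) (auto simp: g_def)
  moreover have "integral {0<..<1} (\<lambda>t. \<bar>g' t\<bar> * (cauchy_density (g t) * H (g t))) =
      integral {0<..<1} (\<lambda>t. H (g t))"
    by (rule integral_cong) (rule jac)
  ultimately have main: "(\<lambda>x. cauchy_density x * H x) absolutely_integrable_on UNIV"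
      "integral UNIV (\<lambda>x. cauchy_density x * H x) = integral {0<..<1} (\<lambda>t. H (g t))"
    using has_absolute_integral_change_of_variables_1'[OF _ der inj,
        of "\<lambda>x. cauchy_density x * H x"] range by auto
  have "integrable lborel (\<lambda>x. cauchy_density x * H x)"
    using main(1) by (simp add: set_integrable_def integrable_completion)
  moreover have "integral\<^sup>L lborel (\<lambda>x. cauchy_density x * H x) = integral {0<..<1} (\<lambda>t. H (g t))"
    using calculation main(2) integral_lborel by metis
  ultimately show ?thesis by (simp add: has_bochner_integral_iff g_def)
qed

lemma has_bochner_integral_cauchy_density_const:
  "has_bochner_integral lborel (\<lambda>x. cauchy_density x * c) c"
proof -
  have "((\<lambda>t::real. c) has_integral c) {0..1}"
    using has_integral_const_real[of c 0 1] by simp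
  then have "integral {0<..<1::real} (\<lambda>t. c) = c"
    by (simp add: integral_open_interval_real[symmetric] integral_unique)
  moreover have "(\<lambda>t::real. c) absolutely_integrable_on {0<..<1}"
    by (rule set_integrable_subset[OF absolutely_integrable_continuous_real[of 0 1]]) auto
  ultimately show ?thesis
    using has_bochner_integral_cauchy_density[of "\<lambda>x. c"] by simp
qed

lemma cayley_tan:
  assumes "t \<in> {0<..<1}"
  shows "cayley (tan (pi * (t - 1/2))) = exp (2 * of_real pi * \<i> * of_real t)"
proof -
  define p where "p = pi * (t - 1/2)"
  have c: "cos p > 0" unfolding p_def using assms by (intro cos_gt_zero_pi) (auto simp: field_simps)
  have "cayley (tan p) = (of_real (sin p) - \<i> * of_real (cos p)) / (of_real (sin p) + \<i> * of_real (cos p))"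
  proof -
    have "of_real (tan p) - \<i> = (of_real (sin p) - \<i> * of_real (cos p)) / of_real (cos p)"
      "of_real (tan p) + \<i> = (of_real (sin p) + \<i> * of_real (cos p)) / of_real (cos p)"
      using c by (simp_all add: tan_def diff_divide_distrib add_divide_distrib)
    then show ?thesis using c by (simp add: cayley_def)
  qed
  also have "\<dots> = - (cis p / cis (- p))"
  proof -
    have "of_real (sin p) - \<i> * of_real (cos p) = - \<i> * cis p"
      "of_real (sin p) + \<i> * of_real (cos p) = \<i> * cis (- p)"
      by (auto simp: complex_eq_iff)
    then show ?thesis by simp
  qed
  also have "\<dots> = cis (2 * p + pi)" by (simp add: cis_divide flip: cis_mult)
  also have "2 * p + pi = 2 * pi * t" by (simp add: p_def algebra_simps)
  also have "cis (2 * pi * t) = exp (2 * of_real pi * \<i> * of_real t)"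
    by (simp add: cis_conv_exp mult_ac)
  finally show ?thesis unfolding p_def .
qed

text \<open>
  The mean value property at 0 of the harmonic function \<open>ln \<bar>1 - c z\<bar>\<close>, read off from Cauchy's formula
  for \<open>Ln (1 - c z)\<close>.
\<close>

lemma integral_ln_norm_circle:
  assumes "norm c < 1"
  shows "(\<lambda>t. ln (norm (1 - c * exp (2 * of_real pi * \<i> * of_real t)))) absolutely_integrable_on {0<..<1}"
    and "integral {0<..<1} (\<lambda>t. ln (norm (1 - c * exp (2 * of_real pi * \<i> * of_real t)))) = 0"
proof -
  define E where "E t = exp (2 * of_real pi * \<i> * of_real t)" for t :: real
  have small: "norm (c * u) < 1" if "norm u \<le> 1" for u
  proof -
    have "norm (c * u) \<le> norm c * 1" unfolding norm_mult using that by (intro mult_left_mono) auto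
    then show ?thesis using assms by simp
  qed
  have nonneg: "1 - c * u \<notin> \<real>\<^sub>\<le>\<^sub>0" if "norm u \<le> 1" for u
  proof
    assume "1 - c * u \<in> \<real>\<^sub>\<le>\<^sub>0"
    then have "Re (c * u) \<ge> 1" by (simp add: complex_nonpos_Reals_iff)
    then show False using small[OF that] complex_Re_le_cmod[of "c * u"] by linarith
  qed
  have nz: "1 - c * u \<noteq> 0" if "norm u \<le> 1" for u using nonneg[OF that] by auto
  have nE: "norm (E t) = 1" for t
  proof -
    have "E t = cis (2 * pi * t)" by (simp add: E_def cis_conv_exp mult_ac)
    then show ?thesis by simp
  qed
  have "(\<lambda>u. Ln (1 - c * u)) holomorphic_on cball 0 1"
    using nonneg by (intro holomorphic_intros) auto
  then have "continuous_on (cball 0 1) (\<lambda>u. Ln (1 - c * u))"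
    "(\<lambda>u. Ln (1 - c * u)) holomorphic_on ball 0 1"
    by (auto intro: holomorphic_on_imp_continuous_on holomorphic_on_subset)
  then have "((\<lambda>u. Ln (1 - c * u) / (u - 0)) has_contour_integral (2 * of_real pi * \<i> * Ln (1 - c * 0)))
          (circlepath 0 1)"
    by (intro Cauchy_integral_circlepath) auto
  moreover have circ: "circlepath 0 1 t = E t" for t by (simp add: circlepath E_def)
  ultimately have "((\<lambda>t. Ln (1 - c * E t) / E t * (2 * of_real pi * \<i> * E t)) has_integral 0) {0..1}"
    unfolding has_contour_integral_def
    by (subst has_integral_cong[where g = "\<lambda>t. Ln (1 - c * circlepath 0 1 t) / (circlepath 0 1 t - 0) *
          vector_derivative (circlepath 0 1) (at t within {0..1})"])
      (simp_all add: circ vector_derivative_circlepath01 flip: E_def)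
  then have "((\<lambda>t. Ln (1 - c * E t) * (2 * of_real pi * \<i>)) has_integral 0) {0..1}"
    by (elim has_integral_eq[rotated]) (simp add: E_def)
  from has_integral_mult_left[OF this, of "1 / (2 * of_real pi * \<i>)"]
  have "((\<lambda>t. Ln (1 - c * E t)) has_integral 0) {0..1}" by simp
  from has_integral_linear[OF this bounded_linear_Re]
  have int0: "((\<lambda>t. ln (norm (1 - c * E t))) has_integral 0) {0..1}"
    using nz nE by (simp add: o_def)
  have "continuous_on {0..1} (\<lambda>t. ln (norm (1 - c * E t)))"
    using nz nE unfolding E_def by (intro continuous_intros) auto
  then have "(\<lambda>t. ln (norm (1 - c * E t))) absolutely_integrable_on {0..1}"
    by (rule absolutely_integrable_continuous_real)
  then show "(\<lambda>t. ln (norm (1 - c * exp (2 * of_real pi * \<i> * of_real t)))) absolutely_integrable_on {0<..<1}"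
    unfolding E_def by (rule set_integrable_subset) auto
  show "integral {0<..<1} (\<lambda>t. ln (norm (1 - c * exp (2 * of_real pi * \<i> * of_real t)))) = 0"
    using int0 unfolding E_def by (simp add: integral_open_interval_real[symmetric] integral_unique)
qed

lemma integral_ln_cayley_factor_open_disc:
  assumes "norm c < 1"
  shows "has_bochner_integral lborel (\<lambda>x. cauchy_density x * ln (norm (1 - c * cayley x))) 0"
proof -
  have eq: "ln (norm (1 - c * cayley (tan (pi * (t - 1/2))))) =
      ln (norm (1 - c * exp (2 * of_real pi * \<i> * of_real t)))" if "t \<in> {0<..<1}" for t
    using cayley_tan[OF that] by simp
  have "(\<lambda>t. ln (norm (1 - c * cayley (tan (pi * (t - 1/2)))))) absolutely_integrable_on {0<..<1}"
    using integral_ln_norm_circle(1)[OF assms] by (subst set_integrable_cong[OF refl refl eq]) auto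
  moreover have "integral {0<..<1} (\<lambda>t. ln (norm (1 - c * cayley (tan (pi * (t - 1/2)))))) = 0"
    using integral_ln_norm_circle(2)[OF assms] by (subst integral_cong[OF eq]) auto
  ultimately show ?thesis
    using has_bochner_integral_cauchy_density[of "\<lambda>x. ln (norm (1 - c * cayley x))"] by simp
qed

lemma AE_cayley_factor_nonzero: "AE x in lborel. 1 - c * cayley x \<noteq> 0"
proof -
  have "x = Re (\<i> * (1 + c) / (c - 1))" if "1 - c * cayley x = 0" for x
  proof -
    have eq: "of_real x + \<i> = c * (of_real x - \<i>)"
      using that by (simp add: cayley_def field_simps)
    have "c \<noteq> 1" using eq by (auto simp: complex_eq_iff)
    then have "of_real x = \<i> * (1 + c) / (c - 1)" using eq by (simp add: field_simps)
    then show ?thesis by (metis Re_complex_of_real)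
  qed
  then have "{x. \<not> 1 - c * cayley x \<noteq> 0} \<subseteq> {Re (\<i> * (1 + c) / (c - 1))}" by auto
  then have "{x. \<not> 1 - c * cayley x \<noteq> 0} \<in> null_sets lborel"
    by (intro finite_imp_null_set_lborel) (rule finite_subset, auto)
  then show ?thesis by (rule AE_I') auto
qed

text \<open>
  For \<open>\<bar>c\<bar> = 1\<close> the integrand has a logarithmic singularity, and the claim is the limit of the case
  \<open>r c\<close> with \<open>r < 1\<close>. Fatou's lemma, applied to \<open>ln 2 - ln \<bar>1 - r c z\<bar> \<ge> 0\<close>, yields integrability, and
  \<open>\<bar>1 - c z\<bar> \<le> 2 \<bar>1 - r c z\<bar>\<close> then provides a dominating function.
\<close>

lemma integral_ln_cayley_factor:
  assumes c: "norm c \<le> 1"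
  shows "has_bochner_integral lborel (\<lambda>x. cauchy_density x * ln (norm (1 - c * cayley x))) 0"
proof -
  define r where "r n = real (Suc n) / real (Suc (Suc n))" for n :: nat
  have r: "0 < r n" "r n < 1" for n by (auto simp: r_def field_simps)
  have r_lim: "r \<longlonglongrightarrow> 1" unfolding r_def by (rule LIMSEQ_Suc[OF LIMSEQ_n_over_Suc_n])
  define b where "b x = norm (1 - c * cayley x)" for x
  define bn where "bn n x = norm (1 - of_real (r n) * c * cayley x)" for n x
  define f where "f x = cauchy_density x * ln (b x)" for x
  define fn where "fn n x = cauchy_density x * ln (bn n x)" for n x
  have [measurable]: "b \<in> borel_measurable borel" "bn n \<in> borel_measurable borel"
    "f \<in> borel_measurable borel" "fn n \<in> borel_measurable borel" for n
    unfolding b_def bn_def f_def fn_def by measurable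
  have cz: "norm (c * cayley x) \<le> 1" for x using c by (simp add: norm_mult)
  have bn_pos: "bn n x > 0" and bn_le: "bn n x \<le> 2" and b_bn: "b x \<le> 2 * bn n x" for n x
  proof -
    have s: "norm (of_real (r n) * c * cayley x) \<le> r n"
      using cz[of x] r[of n] by (simp add: norm_mult mult_left_le)
    have t: "norm (of_real (r n) * c * cayley x) + bn n x \<ge> 1"
      unfolding bn_def using norm_triangle_ineq[of "of_real (r n) * c * cayley x" "1 - of_real (r n) * c * cayley x"]
      by simp
    show "bn n x > 0" using s t r[of n] by linarith
    show "bn n x \<le> 2"
      unfolding bn_def using norm_triangle_ineq4[of 1 "of_real (r n) * c * cayley x"] s r[of n] by simp
    \<comment> \<open>The factor 2 comes from \<open>1 - r \<le> 1 - \<bar>r c z\<bar> \<le> \<bar>1 - r c z\<bar>\<close>.\<close>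
    have "b x \<le> bn n x + norm (of_real (1 - r n) * (c * cayley x))"
      unfolding b_def bn_def
      using norm_triangle_ineq4[of "1 - of_real (r n) * c * cayley x" "of_real (1 - r n) * (c * cayley x)"]
      by (simp add: algebra_simps)
    also have "norm (of_real (1 - r n) * (c * cayley x)) \<le> 1 - r n"
      using cz[of x] r[of n] by (simp only: norm_mult norm_of_real) (simp add: mult_left_le)
    finally show "b x \<le> 2 * bn n x" using s t by linarith
  qed
  have int_fn: "has_bochner_integral lborel (fn n) 0" for n
    using integral_ln_cayley_factor_open_disc[of "of_real (r n) * c"] c r[of n]
    unfolding fn_def bn_def
    by (simp add: norm_mult) (metis c less_eq_real_def mult_left_le norm_ge_zero order.strict_trans1)
  have AE_pos: "AE x in lborel. b x > 0"
    using AE_cayley_factor_nonzero[of c] by eventually_elim (simp add: b_def)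
  have lim: "(\<lambda>n. fn n x) \<longlonglongrightarrow> f x" if "b x > 0" for x
  proof -
    have "(\<lambda>n. bn n x) \<longlonglongrightarrow> norm (1 - of_real 1 * c * cayley x)"
      unfolding bn_def using r_lim by (intro tendsto_intros)
    then show ?thesis
      unfolding fn_def f_def using that by (intro tendsto_intros) (auto simp: b_def)
  qed
  define g where "g x = cauchy_density x * ln 2 - f x" for x
  define gn where "gn n x = cauchy_density x * ln 2 - fn n x" for n x
  have [measurable]: "g \<in> borel_measurable borel" "gn n \<in> borel_measurable borel" for n
    unfolding g_def gn_def by measurable
  have int_gn: "has_bochner_integral lborel (gn n) (ln 2)" for n
    using has_bochner_integral_diff[OF has_bochner_integral_cauchy_density_const[of "ln 2"] int_fn[of n]]
    unfolding gn_def by simp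
  have gn_nonneg: "gn n x \<ge> 0" for n x
    unfolding gn_def fn_def using bn_pos[of n x] bn_le[of n x] cauchy_density_pos[of x]
    by (simp flip: right_diff_distrib)
  have "(\<integral>\<^sup>+x. ennreal (g x) \<partial>lborel) \<le> (\<integral>\<^sup>+x. liminf (\<lambda>n. ennreal (gn n x)) \<partial>lborel)"
  proof (rule nn_integral_mono_AE)
    show "AE x in lborel. ennreal (g x) \<le> liminf (\<lambda>n. ennreal (gn n x))"
      using AE_pos
    proof eventually_elim
      case (elim x)
      have "(\<lambda>n. ennreal (gn n x)) \<longlonglongrightarrow> ennreal (g x)"
        unfolding g_def gn_def by (intro tendsto_ennrealI tendsto_intros lim elim)
      then show ?case by (simp add: lim_imp_Liminf)
    qed
  qed
  also have "\<dots> \<le> liminf (\<lambda>n. \<integral>\<^sup>+x. ennreal (gn n x) \<partial>lborel)"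
    by (intro nn_integral_liminf) measurable
  also have "(\<lambda>n. \<integral>\<^sup>+x. ennreal (gn n x) \<partial>lborel) = (\<lambda>n. ennreal (ln 2))"
    using int_gn gn_nonneg
    by (intro ext) (subst nn_integral_eq_integral, auto simp: has_bochner_integral_iff)
  finally have fin: "(\<integral>\<^sup>+x. ennreal (g x) \<partial>lborel) < \<infinity>"
    by (simp add: Liminf_const) (metis ennreal_less_top le_less_trans)
  have g_nonneg: "AE x in lborel. g x \<ge> 0"
    using AE_pos
  proof eventually_elim
    case (elim x)
    have "b x \<le> 2" using norm_triangle_ineq4[of 1 "c * cayley x"] cz[of x] by (simp add: b_def)
    then show ?case unfolding g_def f_def using elim cauchy_density_pos[of x]
      by (simp flip: right_diff_distrib)
  qed
  have "integrable lborel g"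
    using fin g_nonneg by (intro integrableI_nonneg) auto
  then have int_f: "integrable lborel f"
    using has_bochner_integral_cauchy_density_const[of "ln 2"]
    by (metis (no_types, lifting) ext Bochner_Integration.integrable_diff diff_diff_eq2 add_diff_cancel_left' g_def has_bochner_integral_iff)
  have "(\<lambda>n. integral\<^sup>L lborel (fn n)) \<longlonglongrightarrow> integral\<^sup>L lborel f"
  proof (rule integral_dominated_convergence[where w = "\<lambda>x. cauchy_density x * (2 * ln 2) + \<bar>f x\<bar>"])
    show "integrable lborel (\<lambda>x. cauchy_density x * (2 * ln 2) + \<bar>f x\<bar>)"
      using int_f has_bochner_integral_cauchy_density_const[of "2 * ln 2"]
      by (intro Bochner_Integration.integrable_add integrable_abs) (auto simp: has_bochner_integral_iff)
    show "AE x in lborel. (\<lambda>n. fn n x) \<longlonglongrightarrow> f x" using AE_pos by eventually_elim (rule lim)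
    show "AE x in lborel. norm (fn n x) \<le> cauchy_density x * (2 * ln 2) + \<bar>f x\<bar>" for n
      using AE_pos
    proof eventually_elim
      case (elim x)
      have "ln (bn n x) \<le> ln 2" using bn_pos[of n x] bn_le[of n x] by simp
      moreover have "ln (b x) \<le> ln 2 + ln (bn n x)"
        using elim b_bn[of x n] bn_pos[of n x] by (simp flip: ln_mult_pos)
      moreover have "ln (2::real) > 0" by simp
      ultimately have "\<bar>ln (bn n x)\<bar> \<le> 2 * ln 2 + \<bar>ln (b x)\<bar>" by linarith
      then show ?case unfolding fn_def f_def using cauchy_density_pos[of x]
        by (simp add: abs_mult flip: distrib_left)
    qed
  qed simp_all
  then have "integral\<^sup>L lborel f = 0"
    using int_fn by (simp add: has_bochner_integral_iff LIMSEQ_const_iff)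
  with int_f show ?thesis unfolding f_def b_def by (simp add: has_bochner_integral_iff)
qed

text \<open>
  For \<open>c = (a + \<i>) / (a - \<i>)\<close> and \<open>z\<close> the Cayley transform of \<open>x\<close> one has
  \<open>x - a = (\<i> - a) (1 - c z) / (1 - z)\<close>, and \<open>\<bar>c\<bar> \<le> 1\<close> exactly when \<open>a\<close> is not in the upper half plane.
\<close>

lemma ln_linear_factor_lower_half_plane:
  assumes "Im a \<le> 0"
  shows "has_bochner_integral lborel (\<lambda>x. cauchy_density x * ln (norm (of_real x - a))) (ln (norm (\<i> - a)))"
proof -
  define c where "c = (a + \<i>) / (a - \<i>)"
  have ai: "a - \<i> \<noteq> 0" using assms by (auto simp: complex_eq_iff)
  have "norm (a + \<i>) \<le> norm (a - \<i>)"
    unfolding cmod_def using assms by (simp add: power2_eq_square algebra_simps)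
  then have c: "norm c \<le> 1" using ai by (simp add: c_def norm_divide divide_le_eq_1)
  have "has_bochner_integral lborel
      (\<lambda>x. cauchy_density x * ln (norm (\<i> - a)) + cauchy_density x * ln (norm (1 - c * cayley x))
           - cauchy_density x * ln (norm (1 - 1 * cayley x))) (ln (norm (\<i> - a)) + 0 - 0)"
    using c by (intro has_bochner_integral_add has_bochner_integral_diff integral_ln_cayley_factor
        has_bochner_integral_cauchy_density_const) auto
  moreover have "AE x in lborel. cauchy_density x * ln (norm (\<i> - a)) + cauchy_density x * ln (norm (1 - c * cayley x))
           - cauchy_density x * ln (norm (1 - 1 * cayley x)) = cauchy_density x * ln (norm (of_real x - a))"
    using AE_cayley_factor_nonzero[of c] AE_cayley_factor_nonzero[of 1]
  proof eventually_elim
    case (elim x)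
    have "(of_real x - a) * (1 - 1 * cayley x) = (\<i> - a) * (1 - c * cayley x)"
    proof -
      define p where "p = complex_of_real x + \<i>"
      have p: "p \<noteq> 0" by (simp add: p_def)
      have cz: "cayley x = (of_real x - \<i>) / p" by (simp add: cayley_def p_def)
      have "1 - 1 * cayley x = (p - (of_real x - \<i>)) / p"
        using p by (simp add: cz diff_divide_distrib)
      also have "p - (of_real x - \<i>) = 2 * \<i>" by (simp add: p_def)
      finally have 1: "1 - 1 * cayley x = 2 * \<i> / p" .
      have "1 - c * cayley x = ((a - \<i>) * p - (a + \<i>) * (of_real x - \<i>)) / ((a - \<i>) * p)"
        using p ai by (simp add: cz c_def diff_divide_eq_iff mult.assoc)
      also have "(a - \<i>) * p - (a + \<i>) * (of_real x - \<i>) = 2 * \<i> * (a - of_real x)"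
        by (simp add: p_def algebra_simps)
      finally have 2: "1 - c * cayley x = 2 * \<i> * (a - of_real x) / ((a - \<i>) * p)" .
      have "(\<i> - a) * (2 * \<i> * (a - of_real x)) = (a - \<i>) * (2 * \<i> * (of_real x - a))"
        by (simp add: algebra_simps)
      then have "(\<i> - a) * (1 - c * cayley x) =
          ((a - \<i>) * (2 * \<i> * (of_real x - a))) / ((a - \<i>) * p)"
        unfolding 2 times_divide_eq_right by (simp only:)
      also have "\<dots> = 2 * \<i> * (of_real x - a) / p" using ai by simp
      finally show ?thesis unfolding 1 by (simp add: mult_ac)
    qed
    then have "norm (of_real x - a) * norm (1 - 1 * cayley x) = norm (\<i> - a) * norm (1 - c * cayley x)"
      by (metis norm_mult)
    moreover have pos: "norm (\<i> - a) > 0" "norm (1 - c * cayley x) > 0" "norm (1 - 1 * cayley x) > 0"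
      using ai elim by auto
    ultimately have "norm (of_real x - a) = norm (\<i> - a) * norm (1 - c * cayley x) / norm (1 - 1 * cayley x)"
      by (metis nonzero_mult_div_cancel_right less_irrefl)
    then have "ln (norm (of_real x - a)) = ln (norm (\<i> - a)) + ln (norm (1 - c * cayley x)) - ln (norm (1 - 1 * cayley x))"
      using pos by (simp add: ln_div ln_mult)
    then show ?case by (simp only: distrib_left right_diff_distrib)
  qed
  ultimately show ?thesis
    by (subst has_bochner_integral_cong_AE[symmetric]) (auto intro!: borel_measurable_has_bochner_integral)
qed

text \<open>
  A zero in the upper half plane may be reflected to the lower one: this changes nothing on the real
  line and only increases the modulus at \<open>\<i>\<close>.
\<close>

lemma ln_linear_factor:
  assumes "a \<noteq> \<i>"
  shows "\<exists>L\<ge>ln (norm (\<i> - a)).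
    has_bochner_integral lborel (\<lambda>x. cauchy_density x * ln (norm (of_real x - a))) L"
proof (cases "Im a \<le> 0")
  case True
  then show ?thesis using ln_linear_factor_lower_half_plane by blast
next
  case False
  have "norm (of_real x - a) = norm (of_real x - cnj a)" for x
    by (simp add: cmod_def)
  moreover have "norm (\<i> - a) \<le> norm (\<i> - cnj a)"
    using False by (simp add: cmod_def power2_eq_square algebra_simps)
  then have "ln (norm (\<i> - a)) \<le> ln (norm (\<i> - cnj a))"
    using assms by (intro ln_mono) auto
  ultimately show ?thesis
    using ln_linear_factor_lower_half_plane[of "cnj a"] False by (intro exI[of _ "ln (norm (\<i> - cnj a))"]) auto
qed

lemma AE_poly_nonzero:
  fixes A :: "complex poly"
  assumes "A \<noteq> 0"
  shows "AE x in lborel. poly A (of_real x) \<noteq> 0"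
proof -
  have "finite (of_real -` {z. poly A z = 0} :: real set)"
    using poly_roots_finite[OF assms] by (intro finite_vimageI) (auto simp: inj_on_def)
  then show ?thesis
    by (intro AE_I'[OF finite_imp_null_set_lborel]) auto
qed

text \<open>
  The sub-mean-value inequality of \<open>ln \<bar>A\<bar>\<close> for the Poisson kernel at \<open>\<i>\<close>, obtained by adding up the
  linear factors of \<open>A\<close>.
\<close>

lemma ln_poly_subharmonic:
  fixes A :: "complex poly"
  assumes "poly A \<i> \<noteq> 0"
  shows "\<exists>L\<ge>ln (norm (poly A \<i>)).
    has_bochner_integral lborel (\<lambda>x. cauchy_density x * ln (norm (poly A (of_real x)))) L"
  using assms
proof (induction "degree A" arbitrary: A)
  case 0
  then obtain c where "A = [:c:]" by (metis degree_eq_zeroE)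
  then show ?case
    using has_bochner_integral_cauchy_density_const[of "ln (norm c)"]
    by (intro exI[of _ "ln (norm c)"]) auto
next
  case (Suc n)
  then have "\<not> constant (poly A)" by (simp add: constant_degree)
  then obtain a where "poly A a = 0" using Fundamental_Theorem_Algebra.fundamental_theorem_of_algebra by blast
  then obtain B where AB: "A = [:-a, 1:] * B" by (metis poly_eq_0_iff_dvd dvdE)
  have pA: "poly A z = (z - a) * poly B z" for z by (simp add: AB algebra_simps)
  have nz: "A \<noteq> 0" "B \<noteq> 0" using Suc.prems pA by force+
  have "degree A = degree [:-a, 1:] + degree B"
    unfolding AB by (rule degree_mult_eq) (use nz in auto)
  then have "degree A = Suc (degree B)" by simp
  moreover have Bi: "poly B \<i> \<noteq> 0" "a \<noteq> \<i>" using Suc.prems pA by auto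
  ultimately obtain L1 where L1: "L1 \<ge> ln (norm (poly B \<i>))"
      "has_bochner_integral lborel (\<lambda>x. cauchy_density x * ln (norm (poly B (of_real x)))) L1"
    using Suc.hyps(1)[of B] Suc.hyps(2) by auto
  obtain L2 where L2: "L2 \<ge> ln (norm (\<i> - a))"
      "has_bochner_integral lborel (\<lambda>x. cauchy_density x * ln (norm (of_real x - a))) L2"
    using ln_linear_factor[OF Bi(2)] by blast
  have m: "(\<lambda>x. cauchy_density x * ln (norm (poly A (of_real x)))) \<in> borel_measurable lborel"
    unfolding measurable_lborel2
    by (intro borel_measurable_times borel_measurable_ln borel_measurable_norm
        cauchy_density_measurable borel_measurable_continuous_onI) (auto intro!: continuous_intros)
  have "AE x in lborel. cauchy_density x * ln (norm (of_real x - a)) + cauchy_density x * ln (norm (poly B (of_real x)))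
      = cauchy_density x * ln (norm (poly A (of_real x)))"
    using AE_poly_nonzero[OF nz(1)]
  proof eventually_elim
    case (elim x)
    then show ?case by (simp add: pA norm_mult ln_mult distrib_left)
  qed
  then have "has_bochner_integral lborel (\<lambda>x. cauchy_density x * ln (norm (poly A (of_real x)))) (L2 + L1)"
    using has_bochner_integral_add[OF L2(2) L1(2)] m
    by (subst has_bochner_integral_cong_AE[symmetric])
      (auto intro!: borel_measurable_has_bochner_integral[OF has_bochner_integral_add[OF L2(2) L1(2)]])
  moreover have "ln (norm (poly A \<i>)) \<le> L2 + L1"
    using L1(1) L2(1) Bi by (simp add: pA norm_mult ln_mult)
  ultimately show ?case by blast
qed

text \<open>
  Clearing denominators writes \<open>P = A / u\<^sup>k\<close> with a polynomial \<open>A\<close>. The factor \<open>1 + u\<^sup>2\<close> vanishes at \<open>\<i>\<close>,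
  so \<open>\<bar>A(\<i>)\<bar> = 1\<close> whatever \<open>R\<close> is, and the pole at 0 contributes \<open>ln \<bar>\<i>\<bar> = 0\<close>. Thus \<open>ln \<bar>P\<bar>\<close> has a
  nonnegative Poisson integral at \<open>\<i>\<close>.
\<close>

lemma laurent_sub_mean_value:
  fixes R :: "real poly" and k :: nat
  defines "P \<equiv> \<lambda>u. 1 - (1 + u\<^sup>2) * (poly R u / u ^ k)"
  shows "\<exists>J\<ge>0. has_bochner_integral lborel (\<lambda>u. cauchy_density u * ln \<bar>P u\<bar>) J"
    and "AE u in lborel. P u \<noteq> 0"
proof -
  define A where "A = monom 1 k - [:1, 0, 1:] * map_poly complex_of_real R"
  have pA: "poly A z = z ^ k - (1 + z\<^sup>2) * poly (map_poly of_real R) z" for z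
    by (simp add: A_def poly_monom power2_eq_square algebra_simps)
  have of_real: "poly (map_poly of_real R) (of_real u) = complex_of_real (poly R u)" for u
    by (induction R) (simp_all add: map_poly_pCons)
  have Ai: "poly A \<i> = \<i> ^ k" by (simp add: pA)
  have P_A: "of_real (P u) = poly A (of_real u) / of_real u ^ k" if "u \<noteq> 0" for u
    using that by (simp add: P_def pA of_real diff_divide_distrib)
  have A_nz: "AE u in lborel. poly A (of_real u) \<noteq> 0"
    using Ai by (intro AE_poly_nonzero) auto
  have u_nz: "AE u in lborel. u \<noteq> (0::real)"
    by (rule AE_lborel_singleton)
  show "AE u in lborel. P u \<noteq> 0"
    using A_nz u_nz
  proof eventually_elim
    case (elim u)
    then show ?case using P_A[of u] by (metis divide_eq_0_iff of_real_0 of_real_eq_0_iff power_eq_0_iff)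
  qed
  obtain J where J: "J \<ge> 0" "has_bochner_integral lborel (\<lambda>u. cauchy_density u * ln (norm (poly A (of_real u)))) J"
    using ln_poly_subharmonic[of A] Ai by (auto simp: norm_power)
  have "has_bochner_integral lborel (\<lambda>u. cauchy_density u * ln (norm (complex_of_real u - 0))) (ln (norm (\<i> - 0)))"
    by (rule ln_linear_factor_lower_half_plane) simp
  from has_bochner_integral_diff[OF J(2) has_bochner_integral_mult_right[OF this, of "real k"]]
  have diff: "has_bochner_integral lborel (\<lambda>u. cauchy_density u * ln (norm (poly A (of_real u))) -
      real k * (cauchy_density u * ln \<bar>u\<bar>)) J"
    by simp
  have [measurable]: "P \<in> borel_measurable borel"
    unfolding P_def
    by (intro borel_measurable_diff borel_measurable_times borel_measurable_divide borel_measurable_const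
        borel_measurable_continuous_onI) (auto intro!: continuous_intros)
  have "AE u in lborel. cauchy_density u * ln (norm (poly A (of_real u))) -
      real k * (cauchy_density u * ln \<bar>u\<bar>) = cauchy_density u * ln \<bar>P u\<bar>"
    using A_nz u_nz
  proof eventually_elim
    case (elim u)
    have "\<bar>P u\<bar> = norm (poly A (of_real u)) / \<bar>u\<bar> ^ k"
      using P_A[OF elim(2)] by (metis norm_divide norm_of_real norm_power)
    then have "ln \<bar>P u\<bar> = ln (norm (poly A (of_real u))) - real k * ln \<bar>u\<bar>"
      using elim by (simp add: ln_div ln_realpow)
    then show ?case by (simp only: right_diff_distrib mult.left_commute)
  qed
  then have "has_bochner_integral lborel (\<lambda>u. cauchy_density u * ln \<bar>P u\<bar>) J"
    using diff by (subst has_bochner_integral_cong_AE[symmetric])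
      (auto intro!: borel_measurable_has_bochner_integral[OF diff])
  then show "\<exists>J\<ge>0. has_bochner_integral lborel (\<lambda>u. cauchy_density u * ln \<bar>P u\<bar>) J"
    using J(1) by blast
qed

section \<open>Perturbing a finite measure by a functional\<close>

text \<open>
  A functional on \<open>L\<^sup>1(M)\<close> of norm at most \<open>1/2\<close> corresponds to a signed measure which is dominated by \<open>M/2\<close>,
  so \<open>A \<mapsto> M(A) + l(1\<^sub>A)\<close> is a positive measure. Countable additivity holds because \<open>l\<close> of the
  remainder of a disjoint union is bounded by the \<open>M\<close>-measure of the remainder, and integrals are
  computed by approximation with step functions, as both sides are \<open>L\<^sup>1\<close>-continuous. Constructing the
  measure directly avoids representing \<open>l\<close> by a bounded density.
\<close>

lemma perturbed_measure:
  fixes M :: "'a measure" and l :: "('a \<Rightarrow> real) \<Rightarrow> real"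
  assumes fin: "finite_measure M"
    and add: "\<And>f g. integrable M f \<Longrightarrow> integrable M g \<Longrightarrow> l (\<lambda>x. f x + g x) = l f + l g"
    and scale: "\<And>c f. integrable M f \<Longrightarrow> l (\<lambda>x. c * f x) = c * l f"
    and bound: "\<And>f. integrable M f \<Longrightarrow> \<bar>l f\<bar> \<le> (\<integral>x. \<bar>f x\<bar> \<partial>M) / 2"
  shows "\<exists>\<nu>. sets \<nu> = sets M \<and> finite_measure \<nu> \<and>
    (\<forall>f. integrable M f \<longrightarrow> integrable \<nu> f \<and> (\<integral>x. f x \<partial>\<nu>) = (\<integral>x. f x \<partial>M) + l f)"
proof -
  interpret finite_measure M by fact
  define m where "m A = measure M A + l (indicator A)" for A
  have ind: "integrable M (indicator A :: 'a \<Rightarrow> real)" if "A \<in> sets M" for A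
    using that by (simp add: less_top[symmetric])
  have ind_bound: "\<bar>l (indicator A)\<bar> \<le> measure M A / 2" if "A \<in> sets M" for A
    using bound[OF ind[OF that]] that by (simp add: sets.Int_space_eq2)
  have m_nonneg: "m A \<ge> 0" and m_le: "m A \<le> 2 * measure M A" if "A \<in> sets M" for A
    using ind_bound[OF that] measure_nonneg[of M A] unfolding m_def by linarith+
  have l_diff: "l (\<lambda>x. f x - g x) = l f - l g" if "integrable M f" "integrable M g" for f g
    using add[OF that(1), of "\<lambda>x. - 1 * g x"] scale[OF that(2), of "- 1"] that by simp
  have l_zero: "l (\<lambda>x. 0) = 0" using scale[of "\<lambda>x. 0" 0] by simp
  have sums: "(\<lambda>i. m (A i)) sums m (\<Union>i. A i)"
    if A: "range A \<subseteq> sets M" "disjoint_family A" for A :: "nat \<Rightarrow> 'a set"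
  proof -
    have [measurable]: "A i \<in> sets M" for i using A by auto
    have meas: "(\<lambda>i. measure M (A i)) sums measure M (\<Union>i. A i)"
      using A by (rule finite_measure_UNION)
    define U where "U n = (\<Union>i<n. A i)" for n
    have U_sum: "indicator (U n) x = (\<Sum>i<n. indicator (A i) x :: real)" for n x
      unfolding U_def using A(2) by (intro indicator_UN_disjoint) (auto intro: disjoint_family_on_mono)
    have l_U: "l (indicator (U n)) = (\<Sum>i<n. l (indicator (A i)))"
      and M_U: "measure M (U n) = (\<Sum>i<n. measure M (A i))" for n
    proof -
      have "integrable M (\<lambda>x. \<Sum>i<n. indicator (A i) x :: real) \<and>
          l (\<lambda>x. \<Sum>i<n. indicator (A i) x) = (\<Sum>i<n. l (indicator (A i)))"
      proof (induction n)
        case (Suc n)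
        then show ?case using add[of "\<lambda>x. \<Sum>i<n. indicator (A i) x" "indicator (A n)"] ind[of "A n"] by simp
      qed (simp add: l_zero)
      then show "l (indicator (U n)) = (\<Sum>i<n. l (indicator (A i)))"
        using U_sum[of n] by (metis (no_types, lifting) ext)
      show "measure M (U n) = (\<Sum>i<n. measure M (A i))"
        unfolding U_def using A by (intro finite_measure_finite_Union) (auto intro: disjoint_family_on_mono)
    qed
    have "(\<lambda>n. l (indicator (\<Union>i. A i)) - (\<Sum>i<n. l (indicator (A i)))) \<longlonglongrightarrow> 0"
    proof (rule Lim_null_comparison)
      show "\<forall>\<^sub>F n in sequentially. norm (l (indicator (\<Union>i. A i)) - (\<Sum>i<n. l (indicator (A i)))) \<le>
          (measure M (\<Union>i. A i) - (\<Sum>i<n. measure M (A i))) / 2"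
      proof (rule always_eventually, rule allI)
        fix n
        have [measurable]: "U n \<in> sets M" unfolding U_def by measurable
        have sub: "U n \<subseteq> (\<Union>i. A i)" unfolding U_def by auto
        have "l (indicator (\<Union>i. A i)) - l (indicator (U n)) = l (\<lambda>x. indicator (\<Union>i. A i) x - indicator (U n) x)"
          by (rule l_diff[symmetric]) (intro ind, measurable)+
        also have "(\<lambda>x. indicator (\<Union>i. A i) x - indicator (U n) x) = (indicator ((\<Union>i. A i) - U n) :: 'a \<Rightarrow> real)"
          using sub by (auto simp: fun_eq_iff indicator_def)
        finally have "\<bar>l (indicator (\<Union>i. A i)) - l (indicator (U n))\<bar> \<le> measure M ((\<Union>i. A i) - U n) / 2"
          using ind_bound[of "(\<Union>i. A i) - U n"] by simp
        also have "measure M ((\<Union>i. A i) - U n) = measure M (\<Union>i. A i) - measure M (U n)"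
          using sub by (intro finite_measure_Diff) auto
        finally show "norm (l (indicator (\<Union>i. A i)) - (\<Sum>i<n. l (indicator (A i)))) \<le>
          (measure M (\<Union>i. A i) - (\<Sum>i<n. measure M (A i))) / 2"
          by (simp add: l_U M_U)
      qed
      have "(\<lambda>n. (measure M (\<Union>i. A i) - (\<Sum>i<n. measure M (A i))) / 2) \<longlonglongrightarrow>
          (measure M (\<Union>i. A i) - measure M (\<Union>i. A i)) / 2"
        using meas unfolding sums_def by (intro tendsto_intros) auto
      then show "(\<lambda>n. (measure M (\<Union>i. A i) - (\<Sum>i<n. measure M (A i))) / 2) \<longlonglongrightarrow> 0" by simp
    qed
    from tendsto_diff[OF tendsto_const this, of "l (indicator (\<Union>i. A i))"]
    have "(\<lambda>i. l (indicator (A i))) sums l (indicator (\<Union>i. A i))"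
      by (simp add: sums_def)
    with meas show ?thesis unfolding m_def by (rule sums_add)
  qed
  define \<nu> where "\<nu> = measure_of (space M) (sets M) (\<lambda>A. ennreal (m A))"
  have sets_\<nu> [simp, measurable_cong]: "sets \<nu> = sets M" by (simp add: \<nu>_def)
  have space_\<nu> [simp]: "space \<nu> = space M" by (rule sets_eq_imp_space_eq) simp
  have em: "emeasure \<nu> A = ennreal (m A)" if "A \<in> sets M" for A
    unfolding \<nu>_def
  proof (rule emeasure_measure_of_sigma[OF sets.sigma_algebra_axioms _ _ that])
    show "positive (sets M) (\<lambda>A. ennreal (m A))"
      using l_zero by (simp add: positive_def m_def indicator_def[abs_def])
    show "countably_additive (sets M) (\<lambda>A. ennreal (m A))"
    proof (rule countably_additiveI)
      fix A :: "nat \<Rightarrow> 'a set" assume A: "range A \<subseteq> sets M" "disjoint_family A" "(\<Union>i. A i) \<in> sets M"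
      then show "(\<Sum>i. ennreal (m (A i))) = ennreal (m (\<Union>i. A i))"
        by (intro suminf_ennreal_eq sums m_nonneg) auto
    qed
  qed
  have meas: "measure \<nu> A = m A" if "A \<in> sets M" for A
    using em[OF that] m_nonneg[OF that] by (simp add: measure_def)
  have fin_\<nu>: "finite_measure \<nu>"
    by (rule finite_measureI) (simp add: em)
  have le: "\<nu> \<le> scale_measure 2 M"
  proof (subst le_measure)
    show "\<forall>A\<in>sets \<nu>. emeasure \<nu> A \<le> emeasure (scale_measure 2 M) A"
    proof
      fix A assume "A \<in> sets \<nu>"
      then have A: "A \<in> sets M" by simp
      have "ennreal (m A) \<le> ennreal (2 * measure M A)" using m_le[OF A] by (rule ennreal_leI)
      then show "emeasure \<nu> A \<le> emeasure (scale_measure 2 M) A"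
        using A by (simp add: em emeasure_eq_measure ennreal_mult)
    qed
  qed simp
  have int: "integrable \<nu> f" if f: "integrable M f" for f :: "'a \<Rightarrow> real"
  proof (rule integrableI_bounded)
    show [measurable]: "f \<in> borel_measurable \<nu>" using f by simp
    have "(\<integral>\<^sup>+x. norm (f x) \<partial>\<nu>) \<le> (\<integral>\<^sup>+x. norm (f x) \<partial>scale_measure 2 M)"
      using le by (intro nn_integral_mono_measure) simp_all
    also have "\<dots> = 2 * (\<integral>\<^sup>+x. norm (f x) \<partial>M)"
      using f by (intro nn_integral_scale_measure) simp
    also have "\<dots> < \<infinity>" using f by (simp add: integrable_iff_bounded ennreal_mult_less_top)
    finally show "(\<integral>\<^sup>+x. norm (f x) \<partial>\<nu>) < \<infinity>" .
  qed
  have "(\<integral>x. f x \<partial>\<nu>) = (\<integral>x. f x \<partial>M) + l f" if f: "integrable M f" for f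
    using f
  proof (induction rule: integrable_induct)
    case (base A c)
    have eq: "(\<lambda>x. indicator A x *\<^sub>R c) = (\<lambda>x. c * indicator A x)" by (simp add: mult.commute)
    show ?case unfolding eq using base(1) scale[OF ind[OF base(1)], of c]
      by (simp add: meas m_def sets.Int_space_eq2 distrib_left)
  next
    case (add f g)
    then show ?case using int[OF add(1)] int[OF add(2)] assms(2)[OF add(1,2)] by simp
  next
    case (lim f s)
    note s_int = lim.hyps(1) and s_lim = lim.hyps(2) and s_bd = lim.hyps(3) and f_int = lim.hyps(4)
    have conv: "(\<lambda>i. \<integral>x. s i x \<partial>N) \<longlonglongrightarrow> (\<integral>x. f x \<partial>N)"
      if "integrable N f" "\<And>i. integrable N (s i)" "space N = space M" for N
    proof (rule integral_dominated_convergence[where w = "\<lambda>x. 2 * norm (f x)"])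
      show "AE x in N. (\<lambda>i. s i x) \<longlonglongrightarrow> f x"
        by (rule AE_I2, rule s_lim) (simp only: that)
      show "AE x in N. norm (s i x) \<le> 2 * norm (f x)" for i
        by (rule AE_I2) (use that s_bd in simp)
    qed (use that in auto)
    have "(\<lambda>i. l f - l (s i)) \<longlonglongrightarrow> 0"
    proof (rule Lim_null_comparison)
      show "\<forall>\<^sub>F i in sequentially. norm (l f - l (s i)) \<le> (\<integral>x. \<bar>f x - s i x\<bar> \<partial>M) / 2"
        using bound[OF Bochner_Integration.integrable_diff[OF f_int s_int]]
        by (intro always_eventually allI) (simp add: l_diff s_int f_int)
      have "(\<lambda>i. \<integral>x. \<bar>f x - s i x\<bar> \<partial>M) \<longlonglongrightarrow> (\<integral>x. 0 \<partial>M)"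
      proof (rule integral_dominated_convergence[where w = "\<lambda>x. 3 * norm (f x)"])
        show "AE x in M. (\<lambda>i. \<bar>f x - s i x\<bar>) \<longlonglongrightarrow> 0"
        proof (rule AE_I2)
          fix x assume "x \<in> space M"
          then have "(\<lambda>i. \<bar>f x - s i x\<bar>) \<longlonglongrightarrow> \<bar>f x - f x\<bar>" by (intro tendsto_intros s_lim)
          then show "(\<lambda>i. \<bar>f x - s i x\<bar>) \<longlonglongrightarrow> 0" by simp
        qed
        show "AE x in M. norm \<bar>f x - s i x\<bar> \<le> 3 * norm (f x)" for i
        proof (rule AE_I2)
          fix x assume "x \<in> space M"
          from s_bd[OF this, of i] show "norm \<bar>f x - s i x\<bar> \<le> 3 * norm (f x)"
            unfolding real_norm_def by linarith
        qed
      qed (use s_int f_int in auto)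
      from tendsto_divide[OF this tendsto_const, of 2]
      show "(\<lambda>i. (\<integral>x. \<bar>f x - s i x\<bar> \<partial>M) / 2) \<longlonglongrightarrow> 0" by simp
    qed
    from tendsto_diff[OF tendsto_const this, of "l f"]
    have "(\<lambda>i. l (s i)) \<longlonglongrightarrow> l f" by simp
    from tendsto_add[OF conv[OF f_int s_int refl] this]
    have "(\<lambda>i. \<integral>x. s i x \<partial>\<nu>) \<longlonglongrightarrow> (\<integral>x. f x \<partial>M) + l f" by (simp add: lim.IH)
    with conv[OF int[OF f_int] int[OF s_int] space_\<nu>] show ?case by (rule LIMSEQ_unique)
  qed
  with int fin_\<nu> show ?thesis by (intro exI[of _ \<nu>]) simp
qed

section \<open>Measures induced by distribution functions\<close>

lemma right_limit_Inf:
  fixes F :: "real \<Rightarrow> real"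
  assumes "mono F"
  shows "(F \<longlongrightarrow> Inf (F ` {x<..})) (at_right (x::real))" "Lim (at_right x) F = Inf (F ` {x<..})"
proof -
  show *: "(F \<longlongrightarrow> Inf (F ` {x<..})) (at_right x)"
    using Lim_right_bound[of UNIV x F "F x"] assms by (simp add: mono_def)
  then show "Lim (at_right x) F = Inf (F ` {x<..})" by (intro tendsto_Lim) auto
qed

lemma right_limit_bounds:
  fixes F :: "real \<Rightarrow> real"
  assumes "mono F"
  shows "F x \<le> Lim (at_right x) F" "x < y \<Longrightarrow> Lim (at_right x) F \<le> F (y::real)"
proof -
  have bdd: "bdd_below (F ` {x<..})" using assms by (intro bdd_belowI2[where m = "F x"]) (auto simp: mono_def)
  show "F x \<le> Lim (at_right x) F"
    unfolding right_limit_Inf(2)[OF assms] using assms by (intro cINF_greatest) (auto simp: mono_def)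
  show "Lim (at_right x) F \<le> F y" if "x < y"
    unfolding right_limit_Inf(2)[OF assms] using that by (intro cINF_lower[OF bdd]) auto
qed

lemma right_limit_mono:
  fixes F :: "real \<Rightarrow> real"
  assumes "mono F" "x \<le> y"
  shows "Lim (at_right x) F \<le> Lim (at_right (y::real)) F"
proof (cases "x = y")
  case False
  then show ?thesis
    using right_limit_bounds(2)[OF assms(1), of x y] right_limit_bounds(1)[OF assms(1), of y] assms(2) by simp
qed simp

lemma right_limit_right_continuous:
  fixes F :: "real \<Rightarrow> real"
  assumes "mono F"
  shows "continuous (at_right a) (\<lambda>x. Lim (at_right x) F)"
  unfolding continuous_within
proof (rule order_tendstoI)
  fix b assume "b < Lim (at_right a) F"
  then show "\<forall>\<^sub>F x in at_right a. b < Lim (at_right x) F"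
    unfolding eventually_at_right_field using right_limit_mono[OF assms, of a]
    by (intro exI[of _ "a + 1"]) (auto intro: less_le_trans)
next
  fix b assume "Lim (at_right a) F < b"
  then have "\<forall>\<^sub>F x in at_right a. F x < b"
    using right_limit_Inf[OF assms, of a] by (auto intro: order_tendstoD)
  then obtain c where c: "c > a" "\<And>y. a < y \<Longrightarrow> y < c \<Longrightarrow> F y < b"
    unfolding eventually_at_right_field by blast
  have "Lim (at_right x) F < b" if x: "a < x" "x < c" for x
  proof -
    obtain y where "x < y" "y < c" using dense[OF x(2)] by blast
    with c(2)[of y] right_limit_bounds(2)[OF assms, of x y] x show ?thesis by simp
  qed
  with c(1) show "\<forall>\<^sub>F x in at_right a. Lim (at_right x) F < b"
    unfolding eventually_at_right_field by blast
qed

lemma sets_stieltjes [simp, measurable_cong]: "sets (stieltjes F) = sets borel"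
  by (simp add: stieltjes_def)

lemma space_stieltjes [simp]: "space (stieltjes F) = UNIV"
  by (simp add: stieltjes_def)

lemma emeasure_stieltjes_Ioc:
  assumes "mono F" "a \<le> b"
  shows "emeasure (stieltjes F) {a<..b} = ennreal (Lim (at_right b) F - Lim (at_right a) F)"
  unfolding stieltjes_def
  using assms right_limit_mono right_limit_right_continuous by (intro emeasure_interval_measure_Ioc) auto

lemma finite_measure_stieltjes:
  assumes "distribution_function F"
  shows "finite_measure (stieltjes F)"
proof -
  have F: "mono F" "bounded (range F)" using assms by (auto simp: distribution_function_def)
  obtain B where B: "\<And>x. \<bar>F x\<bar> \<le> B" using F(2) unfolding bounded_iff by auto
  have R: "\<bar>Lim (at_right x) F\<bar> \<le> B" for x
    using right_limit_bounds(1)[OF F(1), of x] right_limit_bounds(2)[OF F(1), of x "x + 1"] B[of x] B[of "x + 1"]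
    by auto
  have "emeasure (stieltjes F) (\<Union>n. {- real n<..real n}) =
      (SUP n. emeasure (stieltjes F) {- real n<..real n})"
    by (intro SUP_emeasure_incseq[symmetric]) (auto simp: incseq_def)
  also have "\<dots> \<le> ennreal (2 * B)"
  proof (rule SUP_least)
    fix n
    show "emeasure (stieltjes F) {- real n<..real n} \<le> ennreal (2 * B)"
      unfolding emeasure_stieltjes_Ioc[OF F(1), of "- real n" "real n", simplified]
      using R[of "real n"] R[of "- real n"] by (intro ennreal_leI) linarith
  qed
  finally show ?thesis
    by (intro finite_measureI) (auto simp: UN_Ioc_eq_UNIV top_unique)
qed

lemma stieltjes_cdf:
  assumes "finite_borel_measure \<nu>"
  shows "stieltjes (cdf \<nu>) = \<nu>"
proof -
  interpret finite_borel_measure \<nu> by fact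
  have "Lim (at_right x) (cdf \<nu>) = cdf \<nu> x" for x
    using cdf_is_right_cont[of x] by (intro tendsto_Lim) (auto simp: continuous_within)
  then have "stieltjes (cdf \<nu>) = interval_measure (cdf \<nu>)" by (simp add: stieltjes_def)
  also have "\<dots> = \<nu>"
  proof (rule cdf_unique'[OF _ assms])
    show "finite_borel_measure (interval_measure (cdf \<nu>))"
      using cdf_nondecreasing cdf_is_right_cont cdf_lim_at_bot cdf_lim_at_top measure_nonneg
      by (rule finite_borel_measure_interval_measure)
    show "cdf (interval_measure (cdf \<nu>)) = cdf \<nu>"
      using cdf_nondecreasing cdf_is_right_cont cdf_lim_at_bot by (rule cdf_interval_measure)
  qed
  finally show ?thesis .
qed

text \<open>
  If \<open>\<nu>\<close> charges every set that \<open>dF\<close> charges, its distribution function strictly increases wherever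
  \<open>F\<close> does, so it inherits the infinitely many points of increase.
\<close>

lemma distribution_function_cdf:
  assumes F: "distribution_function F" and \<nu>: "finite_borel_measure \<nu>"
    and pos: "\<And>A. A \<in> sets borel \<Longrightarrow> measure (stieltjes F) A > 0 \<Longrightarrow> measure \<nu> A > 0"
  shows "distribution_function (cdf \<nu>)"
proof -
  interpret finite_borel_measure \<nu> by fact
  have mono: "mono F" using F by (simp add: distribution_function_def)
  have inc: "cdf \<nu> a < cdf \<nu> b"
    if x: "\<forall>a b. a < x \<and> x < b \<longrightarrow> F a < F b" and ab: "a < x" "x < b" for x a b
  proof -
    \<comment> \<open>The measure of the interval sees the right limit at \<open>a\<close>, which may exceed \<open>F a\<close>.\<close>
    obtain c where c: "a < c" "c < x" using dense[OF ab(1)] by blast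
    have "Lim (at_right a) F \<le> F c" using right_limit_bounds(2)[OF mono c(1)] .
    also have "F c < F b" using x c ab by blast
    also have "F b \<le> Lim (at_right b) F" using right_limit_bounds(1)[OF mono] .
    finally have "measure (stieltjes F) {a<..b} > 0"
      using emeasure_stieltjes_Ioc[OF mono, of a b] ab by (simp add: measure_def)
    then have "measure \<nu> {a<..b} > 0" by (intro pos) auto
    then show ?thesis using cdf_diff_eq[of a b] ab by simp
  qed
  have "{x. \<forall>a b. a < x \<and> x < b \<longrightarrow> F a < F b} \<subseteq>
      {x. \<forall>a b. a < x \<and> x < b \<longrightarrow> cdf \<nu> a < cdf \<nu> b}"
    using inc by blast
  moreover have "infinite {x. \<forall>a b. a < x \<and> x < b \<longrightarrow> F a < F b}"
    using F by (simp add: distribution_function_def)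
  ultimately have "infinite {x. \<forall>a b. a < x \<and> x < b \<longrightarrow> cdf \<nu> a < cdf \<nu> b}"
    by (rule infinite_super)
  moreover have "bounded (range (cdf \<nu>))"
    unfolding bounded_iff using cdf_nonneg cdf_bounded by (intro exI[of _ "measure \<nu> (space \<nu>)"]) auto
  ultimately show ?thesis using cdf_nondecreasing by (simp add: distribution_function_def mono_def)
qed

text \<open>
  Equality of two distribution functions is tested on compactly supported functions only; for finite
  measures it passes to bounded continuous functions by cutting off and dominated convergence.
\<close>

lemma df_equal_integral_bounded:
  fixes f :: "real \<Rightarrow> real"
  assumes eq: "df_equal F G" and fin: "finite_measure (stieltjes F)" "finite_measure (stieltjes G)"
    and f: "continuous_on UNIV f" "\<And>x. \<bar>f x\<bar> \<le> B"
  shows "(\<integral>x. f x \<partial>stieltjes F) = (\<integral>x. f x \<partial>stieltjes G)"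
proof -
  define h where "h n x = max 0 (min 1 (real n - \<bar>x\<bar>))" for n and x :: real
  have h: "0 \<le> h n x" "h n x \<le> 1" for n x by (auto simp: h_def)
  have h_lim: "(\<lambda>n. h n x) \<longlonglongrightarrow> 1" for x
  proof (rule tendsto_eventually)
    obtain N :: nat where N: "1 + \<bar>x\<bar> \<le> real N" using real_arch_simple by blast
    show "\<forall>\<^sub>F n in sequentially. h n x = 1"
      using eventually_ge_at_top[of N]
    proof eventually_elim
      case (elim n)
      then have "1 + \<bar>x\<bar> \<le> real n" using N by linarith
      then show ?case by (simp add: h_def)
    qed
  qed
  have cont: "continuous_on UNIV (\<lambda>x. f x * h n x)" for n
    unfolding h_def by (intro continuous_intros f)
  have meas: "(\<lambda>x. f x * h n x) \<in> borel_measurable borel" "f \<in> borel_measurable borel" for n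
    using cont f by (auto intro: borel_measurable_continuous_onI)
  have bnd: "\<bar>f x * h n x\<bar> \<le> B" for n x
    using mult_mono[OF f(2)[of x] h(2)[of n x]] f(2)[of x] h[of n x] by (simp add: abs_mult)
  have supp: "compact (closure {x. f x * h n x \<noteq> 0})" for n
  proof -
    have "{x. f x * h n x \<noteq> 0} \<subseteq> {- real n..real n}" by (auto simp: h_def)
    then show ?thesis by (metis bounded_closed_interval bounded_subset compact_closure)
  qed
  have lim: "(\<lambda>n. \<integral>x. f x * h n x \<partial>stieltjes H) \<longlonglongrightarrow> (\<integral>x. f x \<partial>stieltjes H)"
    if "finite_measure (stieltjes H)" for H
  proof (rule integral_dominated_convergence[where w = "\<lambda>x. B"])
    show "integrable (stieltjes H) (\<lambda>x. B)" using that by (rule finite_measure.integrable_const)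
    show "AE x in stieltjes H. (\<lambda>n. f x * h n x) \<longlonglongrightarrow> f x"
      using tendsto_mult[OF tendsto_const h_lim] by simp
    show "AE x in stieltjes H. norm (f x * h n x) \<le> B" for n using bnd by simp
  qed (use meas in auto)
  have "(\<integral>x. f x * h n x \<partial>stieltjes F) = (\<integral>x. f x * h n x \<partial>stieltjes G)" for n
    using eq cont supp unfolding df_equal_def by blast
  then show ?thesis using LIMSEQ_unique[OF lim[OF fin(1)]] lim[OF fin(2)] by simp
qed

text \<open>
  Apart from the origin, which carries no mass, the measure is invariant under inversion, and inversion
  exchanges the powers \<open>n\<close> and \<open>-n\<close>.
\<close>

lemma moment_symmetric:
  assumes sym: "symmetric_df F" and zero: "emeasure (stieltjes F) {0} = 0"
  shows "moment F (- n) = moment F n"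
proof -
  define M where "M = stieltjes F"
  define R where "R = restrict_space M (- {0})"
  have sR: "sets R = sets (restrict_space borel (- {0}))"
    unfolding R_def M_def by (rule sets_restrict_space_cong) simp
  have [measurable]: "(\<lambda>u::real. u powi k) \<in> borel_measurable borel" for k
    unfolding power_int_def by measurable
  have AE0: "AE x in M. x \<noteq> 0" unfolding M_def using zero by (intro AE_I'[of "{0}"]) auto
  have restr: "(\<integral>x. f x \<partial>M) = (\<integral>x. f x \<partial>R)" if [measurable]: "f \<in> borel_measurable borel" for f :: "real \<Rightarrow> real"
  proof -
    have "(\<integral>x. f x \<partial>R) = (\<integral>x. indicator (- {0}) x *\<^sub>R f x \<partial>M)"
      unfolding R_def M_def by (subst integral_restrict_space) auto
    also have "\<dots> = (\<integral>x. f x \<partial>M)"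
      using AE0 by (intro integral_cong_AE) (auto simp: M_def)
    finally show ?thesis by simp
  qed
  have inv: "inverse \<in> measurable R (restrict_space borel (- {0}))"
    unfolding measurable_cong_sets[OF sR refl]
    by (intro measurable_restrict_space3) auto
  have "moment F n = (\<integral>x. x powi n \<partial>R)" unfolding moment_def M_def[symmetric] by (rule restr) simp
  also have "\<dots> = (\<integral>x. x powi n \<partial>distr R (restrict_space borel (- {0})) inverse)"
    using sym unfolding symmetric_df_def R_def M_def by simp
  also have "\<dots> = (\<integral>x. inverse x powi n \<partial>R)"
    using inv by (intro integral_distr) (auto intro!: measurable_restrict_space1)
  also have "\<dots> = (\<integral>x. x powi (- n) \<partial>R)"
    by (simp add: power_int_minus power_int_inverse)
  also have "\<dots> = moment F (- n)" unfolding moment_def M_def[symmetric] by (rule restr[symmetric]) simp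
  finally show ?thesis by simp
qed

section \<open>The distance to the Laurent polynomials\<close>

text \<open>
  The positive part of the logarithmic integral is always finite, because \<open>ln y \<le> y\<close> and the density is
  integrable. Hence the hypothesis bounds the negative part, so that the density \<open>\<sigma>'\<close> is a.e. positive
  and has a Poisson-integrable logarithm. The measure \<open>v du\<close> is the absolutely continuous part, so it
  lies below \<open>dF\<close>.
\<close>

lemma density_with_integrable_log:
  assumes F: "distribution_function F" and log: "log_integral F > - \<infinity>"
  shows "\<exists>v. v \<in> borel_measurable borel \<and> (AE u in lborel. v u > 0) \<and>
    integrable lborel (\<lambda>u. cauchy_density u * ln (v u)) \<and>
    (\<forall>f\<in>borel_measurable borel.
       (\<integral>\<^sup>+u. ennreal (v u) * f u \<partial>lborel) \<le> (\<integral>\<^sup>+u. f u \<partial>stieltjes F))"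
proof -
  define M where "M = stieltjes F"
  interpret M: finite_measure M unfolding M_def using F by (rule finite_measure_stieltjes)
  have sM [simp, measurable_cong]: "sets M = sets borel" by (simp add: M_def)
  define N where "N = ac_part M"
  obtain S where dec: "lebesgue_decomposition M N S"
    unfolding N_def using lebesgue_decomposition_ac_part[OF sM M.finite_measure_axioms] by blast
  have sN [simp, measurable_cong]: "sets N = sets borel" and ac: "absolutely_continuous lborel N"
    and emM: "\<And>A. A \<in> sets borel \<Longrightarrow> emeasure M A = emeasure N A + emeasure S A"
    using dec unfolding lebesgue_decomposition_def by auto
  define w where "w = RN_deriv lborel N"
  have [measurable]: "w \<in> borel_measurable borel" unfolding w_def using borel_measurable_RN_deriv[of lborel N] by simp
  have N_w: "density lborel w = N"
    unfolding w_def by (rule sigma_finite_measure.density_RN_deriv[OF sigma_finite_lborel]) (simp_all add: ac)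
  have N_le: "N \<le> M" by (subst le_measure) (auto simp: emM)
  have nn_le: "(\<integral>\<^sup>+u. w u * f u \<partial>lborel) \<le> (\<integral>\<^sup>+u. f u \<partial>M)" if [measurable]: "f \<in> borel_measurable borel" for f
  proof -
    have "(\<integral>\<^sup>+u. w u * f u \<partial>lborel) = (\<integral>\<^sup>+u. f u \<partial>N)"
      unfolding N_w[symmetric] by (subst nn_integral_density) auto
    also have "\<dots> \<le> (\<integral>\<^sup>+u. f u \<partial>M)" using N_le by (intro nn_integral_mono_measure) auto
    finally show ?thesis .
  qed
  have w_fin: "(\<integral>\<^sup>+u. w u \<partial>lborel) < \<infinity>"
  proof -
    have "(\<integral>\<^sup>+u. w u \<partial>lborel) \<le> emeasure M (space M)" using nn_le[of "\<lambda>_. 1"] by simp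
    also have "\<dots> < \<infinity>" using M.emeasure_finite[of "space M"] by (simp add: less_top[symmetric])
    finally show ?thesis .
  qed
  have w_top: "AE u in lborel. w u \<noteq> \<infinity>"
    using w_fin by (intro nn_integral_PInf_AE) auto
  define g where "g u = log_ext (w u) / ereal (1 + u\<^sup>2)" for u
  define P where "P = (\<integral>\<^sup>+u. e2ennreal (g u) \<partial>lborel)"
  define Q where "Q = (\<integral>\<^sup>+u. e2ennreal (- g u) \<partial>lborel)"
  have pos: "0 < 1 + u\<^sup>2" for u :: real by (rule add_pos_nonneg) auto
  have g_0: "g u = - \<infinity>" if "w u = 0" for u
    using that pos[of u] by (simp add: g_def log_ext_def)
  have g_r: "g u = ereal (ln (enn2real (w u)) / (1 + u\<^sup>2))" if "w u \<noteq> 0" "w u \<noteq> \<infinity>" for u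
    using that pos[of u] by (auto simp: g_def log_ext_def)
  have "P \<le> (\<integral>\<^sup>+u. w u \<partial>lborel)"
    unfolding P_def
  proof (rule nn_integral_mono)
    fix u
    consider "w u = 0" | "w u = \<infinity>" | "w u \<noteq> 0" "w u \<noteq> \<infinity>" by blast
    then show "e2ennreal (g u) \<le> w u"
    proof cases
      case 3
      define y where "y = enn2real (w u)"
      have y: "y > 0" "w u = ennreal y"
        using 3 by (auto simp: y_def enn2real_positive_iff less_top zero_less_iff_neq_zero)
      have "0 \<le> y * u\<^sup>2" using y(1) by simp
      then have "ln y \<le> y * (1 + u\<^sup>2)"
        using ln_le_minus_one[OF y(1)] unfolding distrib_left by linarith
      then have "ln y / (1 + u\<^sup>2) \<le> y" using pos[of u] by (simp add: divide_le_eq)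
      then show ?thesis
        unfolding g_r[OF 3] y_def[symmetric] unfolding y(2) by (simp add: e2ennreal_ereal ennreal_leI)
    qed (simp_all add: g_0 e2ennreal_neg)
  qed
  then have P: "P < \<infinity>" using w_fin by (rule le_less_trans)
  have "log_integral F = enn2ereal P - enn2ereal Q"
    unfolding log_integral_def integral_ext_def P_def Q_def g_def ac_derivative_def w_def N_def M_def ..
  then have "Q \<noteq> \<infinity>" using log P by (cases P; cases Q) (auto simp: )
  then have Q: "Q < \<infinity>" by (simp add: less_top)
  \<comment> \<open>Where the density vanishes the integrand of \<open>Q\<close> is infinite, so this set must be null.\<close>
  have "\<infinity> * emeasure lborel {u. w u = 0} = (\<integral>\<^sup>+u. \<infinity> * indicator {u. w u = 0} u \<partial>lborel)"
    by (subst nn_integral_cmult_indicator) auto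
  also have "\<dots> \<le> Q"
    unfolding Q_def by (intro nn_integral_mono) (auto simp: indicator_def g_0)
  finally have "emeasure lborel {u. w u = 0} = 0"
    using Q by (auto simp: ennreal_top_mult top_unique split: if_splits)
  then have w_0: "AE u in lborel. w u \<noteq> 0" by (intro AE_I'[of "{u. w u = 0}"]) auto
  define v where "v u = enn2real (w u)" for u
  have [measurable]: "v \<in> borel_measurable borel" unfolding v_def by measurable
  have v_w: "AE u in lborel. ennreal (v u) = w u"
    using w_top by eventually_elim (simp add: v_def less_top)
  have v_pos: "AE u in lborel. v u > 0"
    using w_0 w_top by eventually_elim (simp add: v_def enn2real_positive_iff less_top zero_less_iff_neq_zero)
  define r where "r u = ln (v u) / (1 + u\<^sup>2)" for u
  have [measurable]: "r \<in> borel_measurable borel" unfolding r_def by measurable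
  have "integrable lborel r"
  proof (rule integrableI_bounded)
    have "(\<integral>\<^sup>+u. ennreal (norm (r u)) \<partial>lborel) = (\<integral>\<^sup>+u. ennreal (r u) + ennreal (- r u) \<partial>lborel)"
      by (intro nn_integral_cong) (simp add: abs_if ennreal_neg)
    also have "\<dots> = (\<integral>\<^sup>+u. ennreal (r u) \<partial>lborel) + (\<integral>\<^sup>+u. ennreal (- r u) \<partial>lborel)"
      by (intro nn_integral_add) auto
    also have "\<dots> = P + Q"
    proof -
      have g_AE: "AE u in lborel. g u = ereal (r u)"
        using w_0 w_top by eventually_elim (simp add: g_r r_def v_def)
      have "(\<integral>\<^sup>+u. ennreal (r u) \<partial>lborel) = P" "(\<integral>\<^sup>+u. ennreal (- r u) \<partial>lborel) = Q"
        unfolding P_def Q_def using g_AE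
        by (auto intro!: nn_integral_cong_AE elim!: eventually_mono simp: e2ennreal_ereal)
      then show ?thesis by simp
    qed
    finally show "(\<integral>\<^sup>+u. ennreal (norm (r u)) \<partial>lborel) < \<infinity>" using P Q by simp
  qed simp
  then have "integrable lborel (\<lambda>u. (1 / pi) * r u)" by simp
  then have "integrable lborel (\<lambda>u. cauchy_density u * ln (v u))"
    by (simp add: r_def cauchy_density_def)
  moreover have "(\<integral>\<^sup>+u. ennreal (v u) * f u \<partial>lborel) \<le> (\<integral>\<^sup>+u. f u \<partial>stieltjes F)"
    if "f \<in> borel_measurable borel" for f
  proof -
    have "(\<integral>\<^sup>+u. ennreal (v u) * f u \<partial>lborel) = (\<integral>\<^sup>+u. w u * f u \<partial>lborel)"
      using v_w by (intro nn_integral_cong_AE) auto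
    then show ?thesis using nn_le[OF that] by (simp add: M_def)
  qed
  ultimately show ?thesis using v_pos by (intro exI[of _ v]) auto
qed

text \<open>
  The quantitative heart of the proof. With \<open>P\<close> as in the sub-mean-value inequality,
  \<open>\<bar>1/(1+u\<^sup>2) - R/u\<^sup>k\<bar> v\<close> is \<open>\<pi>\<close> times the Poisson kernel times \<open>\<bar>P\<bar> v\<close>. By the concavity of the logarithm
  its integral is at least \<open>\<pi>\<close> times the exponential of the Poisson integral of \<open>ln \<bar>P\<bar> + ln v\<close>, and
  dropping the nonnegative contribution of \<open>ln \<bar>P\<bar>\<close> leaves a bound that depends on \<open>v\<close> alone.
\<close>

lemma laurent_distance:
  assumes F: "distribution_function F" and log: "log_integral F > - \<infinity>"
  shows "\<exists>d>0. \<forall>(R :: real poly) k. integrable (stieltjes F) (\<lambda>u. 1 / (1 + u\<^sup>2) - poly R u / u ^ k) \<longrightarrow>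
    d \<le> (\<integral>u. \<bar>1 / (1 + u\<^sup>2) - poly R u / u ^ k\<bar> \<partial>stieltjes F)"
proof -
  obtain v where [measurable]: "v \<in> borel_measurable borel" and v_pos: "AE u in lborel. v u > 0"
    and v_int: "integrable lborel (\<lambda>u. cauchy_density u * ln (v u))"
    and v_le: "\<And>f. f \<in> borel_measurable borel \<Longrightarrow>
      (\<integral>\<^sup>+u. ennreal (v u) * f u \<partial>lborel) \<le> (\<integral>\<^sup>+u. f u \<partial>stieltjes F)"
    using density_with_integrable_log[OF F log] by blast
  define c where "c = (\<integral>u. cauchy_density u * ln (v u) \<partial>lborel)"
  have c: "has_bochner_integral lborel (\<lambda>u. cauchy_density u * ln (v u)) c"
    using v_int by (simp add: c_def has_bochner_integral_iff)
  have "pi * exp c \<le> (\<integral>u. \<bar>1 / (1 + u\<^sup>2) - poly R u / u ^ k\<bar> \<partial>stieltjes F)"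
    if int: "integrable (stieltjes F) (\<lambda>u. 1 / (1 + u\<^sup>2) - poly R u / u ^ k)" for R :: "real poly" and k
  proof -
    define h where "h u = 1 / (1 + u\<^sup>2) - poly R u / u ^ k" for u
    define P where "P u = 1 - (1 + u\<^sup>2) * (poly R u / u ^ k)" for u
    have pos: "0 < 1 + u\<^sup>2" for u :: real by (rule add_pos_nonneg) auto
    have h_P: "\<bar>h u\<bar> = pi * cauchy_density u * \<bar>P u\<bar>" for u
    proof -
      have "h u = P u / (1 + u\<^sup>2)" using pos[of u] by (simp add: h_def P_def field_simps)
      then show ?thesis using pos[of u] by (simp add: cauchy_density_def)
    qed
    obtain J where J: "J \<ge> 0" "has_bochner_integral lborel (\<lambda>u. cauchy_density u * ln \<bar>P u\<bar>) J"
      unfolding P_def using laurent_sub_mean_value(1) by blast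
    have P_nz: "AE u in lborel. P u \<noteq> 0" unfolding P_def by (rule laurent_sub_mean_value(2))
    \<comment> \<open>Jensen's inequality in tangent form: \<open>\<pi> K \<bar>P\<bar> v\<close> dominates \<open>f\<close>, where \<open>K\<close> is the kernel, since \<open>e\<^sup>y \<ge> e\<^sup>c (1 + y - c)\<close> for \<open>y = ln \<bar>P\<bar> + ln v\<close>.\<close>
    define f where "f u = pi * exp c *
      (cauchy_density u * (1 - c) + cauchy_density u * ln \<bar>P u\<bar> + cauchy_density u * ln (v u))" for u
    have f: "has_bochner_integral lborel f (pi * exp c * ((1 - c) + J + c))"
      unfolding f_def
      by (intro has_bochner_integral_mult_right has_bochner_integral_add
          has_bochner_integral_cauchy_density_const J c)
    have int_h: "integrable (stieltjes F) h" using int unfolding h_def .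
    then have [measurable]: "h \<in> borel_measurable borel" by simp
    have f_int: "integrable lborel f" "integral\<^sup>L lborel f = pi * exp c * (1 + J)"
      using f by (simp_all add: has_bochner_integral_iff)
    have "pi * exp c * 1 \<le> pi * exp c * (1 + J)" using J(1) by (intro mult_left_mono) auto
    also have "\<dots> = integral\<^sup>L lborel f" using f_int by simp
    also have "\<dots> \<le> (\<integral>u. max 0 (f u) \<partial>lborel)" using f_int by (intro integral_mono) auto
    finally have "ennreal (pi * exp c) \<le> ennreal (\<integral>u. max 0 (f u) \<partial>lborel)"
      by (simp add: ennreal_leI)
    also have "\<dots> = (\<integral>\<^sup>+u. ennreal (max 0 (f u)) \<partial>lborel)"
      using f_int by (intro nn_integral_eq_integral[symmetric]) auto
    also have "\<dots> \<le> (\<integral>\<^sup>+u. ennreal (v u) * ennreal \<bar>h u\<bar> \<partial>lborel)"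
    proof (rule nn_integral_mono_AE)
      show "AE u in lborel. ennreal (max 0 (f u)) \<le> ennreal (v u) * ennreal \<bar>h u\<bar>"
        using v_pos P_nz
      proof eventually_elim
        case (elim u)
        define y where "y = ln \<bar>P u\<bar> + ln (v u)"
        have "exp c * (1 + (y - c)) \<le> exp c * exp (y - c)"
          by (intro mult_left_mono exp_ge_add_one_self) auto
        also have "\<dots> = \<bar>P u\<bar> * v u"
          using elim by (simp add: y_def exp_add exp_diff)
        finally have "pi * cauchy_density u * (exp c * (1 + (y - c))) \<le> pi * cauchy_density u * (\<bar>P u\<bar> * v u)"
          using cauchy_density_pos[of u] by (intro mult_left_mono) auto
        then have "f u \<le> v u * \<bar>h u\<bar>"
          unfolding h_P f_def y_def by (simp add: algebra_simps)
        then show ?case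
          using elim by (simp flip: ennreal_mult'' add: ennreal_leI)
      qed
    qed
    also have "\<dots> \<le> (\<integral>\<^sup>+u. ennreal \<bar>h u\<bar> \<partial>stieltjes F)" by (rule v_le) measurable
    also have "\<dots> = ennreal (\<integral>u. \<bar>h u\<bar> \<partial>stieltjes F)"
      using int_h by (intro nn_integral_eq_integral) auto
    finally have "pi * exp c \<le> (\<integral>u. \<bar>h u\<bar> \<partial>stieltjes F)"
      by (subst (asm) ennreal_le_iff) auto
    then show ?thesis by (simp add: h_def)
  qed
  then show ?thesis by (intro exI[of _ "pi * exp c"]) auto
qed

text \<open>
  With the pointwise vector space structure the Laurent polynomials are the linear span of the integer
  powers, to which the separation result applies directly.
\<close>

instantiation "fun" :: (type, real_vector) real_vector
begin

definition scaleR_fun_def: "c *\<^sub>R f = (\<lambda>x. c *\<^sub>R f x)"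

instance
  by standard (auto simp: fun_eq_iff plus_fun_def scaleR_fun_def scaleR_add_right scaleR_add_left)

end

lemma laurent_span_form:
  assumes "w \<in> span (range (\<lambda>n u. u powi n :: real))"
  shows "\<exists>(R :: real poly) k. \<forall>u. u \<noteq> 0 \<longrightarrow> w u = poly R u / u ^ k"
  using assms
proof (induction rule: span_induct_alt)
  case base
  show ?case by (intro exI[of _ 0]) (simp add: zero_fun_def)
next
  case (step c x y)
  obtain n where x: "x = (\<lambda>u. u powi n)" using step.hyps by blast
  obtain R k where y: "\<And>u. u \<noteq> 0 \<Longrightarrow> y u = poly R u / u ^ k" using step.IH by blast
  show ?case
  proof (cases "n \<ge> 0")
    case True
    then have "(c *\<^sub>R x + y) u = poly (monom c (nat n + k) + R) u / u ^ k" if "u \<noteq> 0" for u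
      using that y[OF that]
      by (simp add: x plus_fun_def scaleR_fun_def poly_monom power_int_def power_add add_divide_distrib)
    then show ?thesis by blast
  next
    case False
    then have "(c *\<^sub>R x + y) u = poly (monom c k + R * monom 1 (nat (- n))) u / u ^ (k + nat (- n))" if "u \<noteq> 0" for u
    proof -
      have "c / U + r / V = (c * V + r * U) / (V * U)" if "U \<noteq> 0" "V \<noteq> 0" for U V r :: real
        using that by (simp add: field_simps)
      from this[of "u ^ nat (- n)" "u ^ k" "poly R u"] show ?thesis
        using that y[OF that] False
        by (simp add: x plus_fun_def scaleR_fun_def poly_monom power_int_def power_add divide_inverse power_inverse)
    qed
    then show ?thesis by blast
  qed
qed

section \<open>Indeterminacy\<close>

theorem theorem2p1:
  fixes \<sigma> :: "real \<Rightarrow> real" and \<mu> :: "int \<Rightarrow> real"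
  assumes "distribution_function \<sigma>"
    and "symmetric_df \<sigma>"
    and "\<And>n. finite_moment \<sigma> n"
    and "\<And>n. \<mu> n = moment \<sigma> n"
    and "log_integral \<sigma> > - \<infinity>"
  shows "strong_hamburger_indeterminate \<mu> \<and> (\<forall>n. \<mu> n = \<mu> (- n))"
proof
  have zero: "emeasure (stieltjes \<sigma>) {0} = 0"
    using assms(3)[of "- 1"] by (simp add: finite_moment_def)
  then show "\<forall>n. \<mu> n = \<mu> (- n)"
    using moment_symmetric[OF assms(2)] assms(4) by simp
  define M where "M = stieltjes \<sigma>"
  have fin: "finite_measure M" unfolding M_def using assms(1) by (rule finite_measure_stieltjes)
  then interpret M: finite_measure M .
  have sM [simp, measurable_cong]: "sets M = sets borel" by (simp add: M_def)
  have AE0: "AE x in M. x \<noteq> 0"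
    unfolding M_def using zero by (intro AE_I'[of "{0}"]) auto
  have pow_int: "integrable M (\<lambda>u. u powi n)" for n
    using assms(3)[of n] by (simp add: finite_moment_def M_def)
  define E where "E = {f :: real \<Rightarrow> real. integrable M f}"
  define N where "N f = (\<integral>u. \<bar>f u\<bar> \<partial>M)" for f :: "real \<Rightarrow> real"
  define W where "W = span (range (\<lambda>n u. u powi n :: real))"
  define f0 where "f0 u = 1 / (1 + u\<^sup>2)" for u :: real
  have f0_cont: "continuous_on UNIV f0"
    unfolding f0_def by (intro continuous_intros) (auto simp: add_nonneg_eq_0_iff)
  have f0_bd: "\<bar>f0 u\<bar> \<le> 1" for u
    using divide_le_eq_1_pos[of "1 + u\<^sup>2" 1] add_pos_nonneg[of 1 "u\<^sup>2"] by (simp add: f0_def)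
  have [measurable]: "f0 \<in> borel_measurable borel"
    using f0_cont by (rule borel_measurable_continuous_onI)
  have f0_int: "integrable M f0"
    using f0_bd by (intro M.integrable_const_bound[where B = 1]) auto
  obtain d where d: "d > 0" and dist: "\<And>(R :: real poly) k.
      integrable M (\<lambda>u. f0 u - poly R u / u ^ k) \<Longrightarrow> d \<le> (\<integral>u. \<bar>f0 u - poly R u / u ^ k\<bar> \<partial>M)"
    using laurent_distance[OF assms(1,5)] unfolding M_def f0_def by blast
  have E: "subspace E"
    unfolding subspace_def E_def by (auto simp: zero_fun_def plus_fun_def scaleR_fun_def)
  have W: "subspace W" "W \<subseteq> E"
    unfolding W_def by simp (rule span_minimal, use pow_int E in \<open>auto simp: E_def\<close>)
  have "sublinear_on E N"
  proof (rule sublinear_onI)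
    fix f g assume "f \<in> E" "g \<in> E"
    then have "N (f + g) \<le> (\<integral>u. \<bar>f u\<bar> + \<bar>g u\<bar> \<partial>M)"
      unfolding N_def E_def plus_fun_def by (intro integral_mono) auto
    also have "\<dots> = N f + N g"
      unfolding N_def using \<open>f \<in> E\<close> \<open>g \<in> E\<close> by (intro Bochner_Integration.integral_add) (auto simp: E_def)
    finally show "N (f + g) \<le> N f + N g" .
  next
    fix c :: real and f assume "c > 0" "f \<in> E"
    then show "N (c *\<^sub>R f) \<le> c * N f" by (simp add: N_def scaleR_fun_def abs_mult)
  qed
  moreover have "N (- f) = N f" for f by (simp add: N_def fun_Compl_def)
  moreover have "f0 \<in> E" using f0_int by (simp add: E_def)
  moreover have "d \<le> N (f0 - w)" if w: "w \<in> W" for w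
  proof -
    obtain R :: "real poly" and k where Rk: "\<And>u. u \<noteq> 0 \<Longrightarrow> w u = poly R u / u ^ k"
      using laurent_span_form w unfolding W_def by blast
    have w_int: "integrable M w" using w W(2) by (auto simp: E_def)
    have [measurable]: "poly R \<in> borel_measurable borel" "w \<in> borel_measurable borel"
      using w_int by (auto intro!: borel_measurable_continuous_onI continuous_intros)
    have ae: "AE u in M. f0 u - w u = f0 u - poly R u / u ^ k"
      using AE0 by eventually_elim (simp add: Rk)
    have "integrable M (\<lambda>u. f0 u - w u)" using f0_int w_int by simp
    then have "integrable M (\<lambda>u. f0 u - poly R u / u ^ k)"
      using ae by (subst integrable_cong_AE[symmetric]) auto
    from dist[OF this] have "d \<le> (\<integral>u. \<bar>f0 u - poly R u / u ^ k\<bar> \<partial>M)" .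
    also have "\<dots> = (\<integral>u. \<bar>f0 u - w u\<bar> \<partial>M)"
      using ae by (intro integral_cong_AE) auto
    finally show ?thesis by (simp add: N_def fun_diff_def)
  qed
  ultimately have "\<exists>l. (\<forall>f\<in>E. \<forall>g\<in>E. l (f + g) = l f + l g) \<and> (\<forall>c. \<forall>f\<in>E. l (c *\<^sub>R f) = c * l f) \<and>
      (\<forall>f\<in>E. \<bar>l f\<bar> \<le> N f) \<and> (\<forall>w\<in>W. l w = 0) \<and> d \<le> l f0"
    by (intro separating_linear_functional[OF E W]) auto
  then obtain l where add: "\<And>f g. f \<in> E \<Longrightarrow> g \<in> E \<Longrightarrow> l (f + g) = l f + l g"
    and scale: "\<And>c f. f \<in> E \<Longrightarrow> l (c *\<^sub>R f) = c * l f"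
    and bound: "\<And>f. f \<in> E \<Longrightarrow> \<bar>l f\<bar> \<le> N f"
    and l_W: "\<And>w. w \<in> W \<Longrightarrow> l w = 0" and l_f0: "d \<le> l f0"
    by metis
  \<comment> \<open>Halving \<open>l\<close> keeps \<open>M/2 \<le> \<nu>\<close>, so that no point of increase is lost.\<close>
  have "\<exists>\<nu>. sets \<nu> = sets M \<and> finite_measure \<nu> \<and>
    (\<forall>f. integrable M f \<longrightarrow> integrable \<nu> f \<and> (\<integral>x. f x \<partial>\<nu>) = (\<integral>x. f x \<partial>M) + l f / 2)"
    using add scale bound unfolding E_def N_def plus_fun_def scaleR_fun_def
    by (intro perturbed_measure[OF fin]) (auto simp: add_divide_distrib)
  then obtain \<nu> where s\<nu>: "sets \<nu> = sets borel" and fin\<nu>: "finite_measure \<nu>"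
    and vals: "\<forall>f. integrable M f \<longrightarrow>
      integrable \<nu> f \<and> (\<integral>x. f x \<partial>\<nu>) = (\<integral>x. f x \<partial>M) + l f / 2"
    unfolding sM by blast
  note int = vals[rule_format, THEN conjunct1] and val = vals[rule_format, THEN conjunct2]
  interpret \<nu>: finite_borel_measure \<nu>
    using fin\<nu> s\<nu> by (simp add: finite_borel_measure_def finite_borel_measure_axioms_def)
  have meas: "measure M A / 2 \<le> measure \<nu> A" "measure \<nu> A \<le> 2 * measure M A" if A: "A \<in> sets borel" for A
  proof -
    have i: "integrable M (indicator A :: real \<Rightarrow> real)" using A by (simp add: less_top[symmetric])
    have "\<bar>l (indicator A)\<bar> \<le> measure M A"
      using bound[of "indicator A"] i A by (simp add: E_def N_def M_def)
    moreover have "measure \<nu> A = measure M A + l (indicator A) / 2"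
      using val[OF i] A s\<nu> by (simp add: M_def \<nu>.borel_UNIV)
    ultimately show "measure M A / 2 \<le> measure \<nu> A" "measure \<nu> A \<le> 2 * measure M A"
      using measure_nonneg[of M A] by linarith+
  qed
  define G where "G = cdf \<nu>"
  have G\<nu>: "stieltjes G = \<nu>" unfolding G_def by (rule stieltjes_cdf) standard
  have "solves_strong_hamburger \<mu> G"
    unfolding solves_strong_hamburger_def
  proof (intro conjI allI)
    show "distribution_function G"
      unfolding G_def
    proof (rule distribution_function_cdf[OF assms(1) \<nu>.finite_borel_measure_axioms])
      fix A :: "real set" assume A: "A \<in> sets borel" "measure (stieltjes \<sigma>) A > 0"
      then show "measure \<nu> A > 0" using meas(1)[OF A(1)] by (simp add: M_def)
    qed
    fix n
    have "l (\<lambda>u. u powi n) = 0" by (intro l_W) (auto simp: W_def intro: span_base)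
    then show "\<mu> n = moment G n"
      using val[OF pow_int[of n]] assms(4)[of n] by (simp add: moment_def G\<nu> M_def)
    \<comment> \<open>Negative moments require that the new solution has no atom at the origin either.\<close>
    have "measure \<nu> {0} \<le> 0" using meas(2)[of "{0}"] zero by (simp add: M_def measure_def)
    then have "emeasure \<nu> {0} = 0" using measure_nonneg[of \<nu> "{0}"] by (simp add: \<nu>.emeasure_eq_measure)
    then show "finite_moment G n" using int[OF pow_int] by (simp add: finite_moment_def G\<nu>)
  qed
  moreover have "solves_strong_hamburger \<mu> \<sigma>"
    using assms by (simp add: solves_strong_hamburger_def)
  moreover have "\<not> df_equal \<sigma> G"
  proof
    assume "df_equal \<sigma> G"
    then have "(\<integral>x. f0 x \<partial>M) = (\<integral>x. f0 x \<partial>\<nu>)"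
      using df_equal_integral_bounded[of \<sigma> G f0 1] fin fin\<nu> f0_cont f0_bd by (simp add: M_def G\<nu>)
    then show False using val[OF f0_int] l_f0 d by simp
  qed
  ultimately show "strong_hamburger_indeterminate \<mu>"
    unfolding strong_hamburger_indeterminate_def strong_hamburger_determinate_def by blast
qed

end
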